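(* Let $X$ be a Banach space with the metric $\pi$-property and let $N\in\mathbb{N}$. Then every symmetric tensor can be approximated by symmetric tensors which attain their norms, that is, $\overline{\mathrm{NA}_{\pi,s,N}(X)}^{\|\cdot\|_{\pi,s,N}}=\widehat{\otimes}_{\pi,s,N}X$.
   Context: $\mathbb{K}$ (the scalar field) is $\mathbb{R}$ or $\mathbb{C}$; $B_X$ and $S_X$ are the closed unit ball and unit sphere of $X$. $X$ has the metric $\pi$-property if, given $\varepsilon>0$ and $\{x_1,\dots,x_n\}\subseteq S_X$, there are a finite-dimensional $1$-complemented subspace $M\subseteq X$ (i.e. the range of a norm-one linear projection on $X$) and $x_i'\in M$ with $\|x_i-x_i'\|<\varepsilon$ for every $i=1,\dots,n$. For $z\in X$, $z^N:=z\otimes\cdots\otimes z$ ($N$ times). The $N$-fold projective symmetric tensor product $\widehat{\otimes}_{\pi,s,N}X$ is the completion of the linear span of $\{z^N:z\in X\}$ under the norm $\|z\|_{\pi,s,N}=\inf\{\sum_{k=1}^n|\lambda_k|: z=\sum_{k=1}^n\lambda_k x_k^N,\ n\in\mathbb{N},\ x_k\in S_X,\ \lambda_k\in\mathbb{K}\}$. An element $z\in\widehat{\otimes}_{\pi,s,N}X$ attains its norm if there are bounded sequences $(\lambda_n)_{n=1}^\infty\subset\mathbb{K}$ and $(x_n)_{n=1}^\infty\subset B_X$ with $z=\sum_{n=1}^\infty\lambda_n x_n^N$ and $\|z\|_{\pi,s,N}=\sum_{n=1}^\infty|\lambda_n|$; the set of all such $z$ is denoted $\mathrm{NA}_{\pi,s,N}(X)$.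 *)

theory Defs
  imports "HOL-Analysis.Analysis" "HOL-Library.Function_Algebras"
begin

section \<open>Banach spaces over the real or the complex numbers\<close>

text \<open>
  The scalar field is a type of sort \<open>{real_normed_field, euclidean_space}\<close>. Both
  \<^typ>\<open>real\<close> and \<^typ>\<open>complex\<close> have this sort, and up to isometric isomorphism they are the only
  fields that do: a commutative real division algebra of finite dimension is the reals or the
  complex numbers, and a multiplicative norm extending the absolute value of the reals is unique.
  The type class \<^class>\<open>banach\<close> supplies the underlying real Banach space, and \<open>scl\<close> the
  multiplication by scalars (for real scalars the compatibility axiom forces \<open>scl = scaleR\<close>).
\<close>

locale banach_space_over = vector_space scl
  for scl :: "'k::{real_normed_field, euclidean_space} \<Rightarrow> 'a::banach \<Rightarrow> 'a" +
  assumes scale_of_real: "scl (of_real r) x = r *\<^sub>R x"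
    and norm_scale: "norm (scl c x) = norm c * norm x"

lemma banach_space_over_real: "banach_space_over (scaleR :: real \<Rightarrow> 'a::banach \<Rightarrow> 'a)"
  by unfold_locales (auto simp: algebra_simps)

lemma banach_space_over_complex: "banach_space_over ((*) :: complex \<Rightarrow> complex \<Rightarrow> complex)"
  by unfold_locales (auto simp: algebra_simps norm_mult scaleR_conv_of_real)

definition finite_dimensional_subspace ::
  "('k::field \<Rightarrow> 'a::ab_group_add \<Rightarrow> 'a) \<Rightarrow> 'a set \<Rightarrow> bool" where
  "finite_dimensional_subspace scl M \<longleftrightarrow> (\<exists>B. finite B \<and> M = module.span scl B)"

definition one_complemented ::
  "('k::field \<Rightarrow> 'a::real_normed_vector \<Rightarrow> 'a) \<Rightarrow> 'a set \<Rightarrow> bool" where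
  "one_complemented scl M \<longleftrightarrow>
    (\<exists>P. Vector_Spaces.linear scl scl P \<and> bounded_linear P \<and> P \<circ> P = P \<and>
         onorm P = 1 \<and> range P = M)"

text \<open>
  Only nonempty sets of unit vectors are tested. For \<open>X \<noteq> {0}\<close> this makes no difference, and it
  does not exclude the space \<open>X = {0}\<close>, which has no projection of norm one.
\<close>

definition metric_pi_property ::
  "('k::field \<Rightarrow> 'a::real_normed_vector \<Rightarrow> 'a) \<Rightarrow> bool" where
  "metric_pi_property scl \<longleftrightarrow>
    (\<forall>\<epsilon>>0. \<forall>F. finite F \<longrightarrow> F \<noteq> {} \<longrightarrow> F \<subseteq> sphere 0 1 \<longrightarrow>
      (\<exists>M. finite_dimensional_subspace scl M \<and> one_complemented scl M \<and>
           (\<forall>x\<in>F. \<exists>x'\<in>M. norm (x - x') < \<epsilon>)))"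


section \<open>Algebraic tensors\<close>

text \<open>
  An \<open>N\<close>-tuple is a list of length \<open>N\<close>; the values of a multilinear map on lists of any other
  length are irrelevant.
\<close>

definition multilinear_map ::
  "('k::field \<Rightarrow> 'a::ab_group_add \<Rightarrow> 'a) \<Rightarrow> ('k \<Rightarrow> 'b::ab_group_add \<Rightarrow> 'b) \<Rightarrow> nat \<Rightarrow>
    ('a list \<Rightarrow> 'b) \<Rightarrow> bool" where
  "multilinear_map scl sclB N T \<longleftrightarrow>
    (\<forall>xs i. length xs = N \<longrightarrow> i < N \<longrightarrow> Vector_Spaces.linear scl sclB (\<lambda>x. T (xs[i := x])))"

text \<open>
  The algebraic tensor product is realised, as is usual in Banach space theory, inside the algebraic
  dual of the space of \<open>N\<close>-linear forms: \<open>x\<^sub>1 \<otimes> \<dots> \<otimes> x\<^sub>N\<close> is the evaluation \<open>A \<mapsto> A (x\<^sub>1, \<dots>, x\<^sub>N)\<close>.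
  Arguments \<open>A\<close> that are not \<open>N\<close>-linear are sent to \<open>0\<close>, so that equality of functions is equality
  of tensors. Lemmas \<open>multilinear_pure_tensor\<close> and \<open>pure_tensor_universal\<close> below show that the span
  of the pure tensors is the algebraic tensor product.
\<close>

type_synonym ('k, 'a) tensor = "('a list \<Rightarrow> 'k) \<Rightarrow> 'k"

definition pure_tensor ::
  "('k::field \<Rightarrow> 'a::ab_group_add \<Rightarrow> 'a) \<Rightarrow> nat \<Rightarrow> 'a list \<Rightarrow> ('k, 'a) tensor" where
  "pure_tensor scl N xs = (\<lambda>A. if multilinear_map scl (*) N A then A xs else 0)"

definition tensor_scale :: "'k::field \<Rightarrow> ('k, 'a) tensor \<Rightarrow> ('k, 'a) tensor" where
  "tensor_scale c t = (\<lambda>A. c * t A)"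

definition tensor_power ::
  "('k::field \<Rightarrow> 'a::ab_group_add \<Rightarrow> 'a) \<Rightarrow> nat \<Rightarrow> 'a \<Rightarrow> ('k, 'a) tensor" where
  "tensor_power scl N z = pure_tensor scl N (replicate N z)"

definition sym_tensors ::
  "('k::field \<Rightarrow> 'a::ab_group_add \<Rightarrow> 'a) \<Rightarrow> nat \<Rightarrow> ('k, 'a) tensor set" where
  "sym_tensors scl N = module.span tensor_scale (range (tensor_power scl N))"

definition sym_proj_norm ::
  "('k::real_normed_field \<Rightarrow> 'a::real_normed_vector \<Rightarrow> 'a) \<Rightarrow> nat \<Rightarrow> ('k, 'a) tensor \<Rightarrow> real" where
  "sym_proj_norm scl N z =
    Inf {(\<Sum>k<n. norm (c k)) | (n::nat) c x.
           (\<forall>k<n. x k \<in> sphere 0 1) \<and>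
           z = (\<Sum>k<n. tensor_scale (c k) (tensor_power scl N (x k)))}"

lemma vector_space_tensor_scale: "vector_space (tensor_scale :: 'k::field \<Rightarrow> _)"
  by unfold_locales (auto simp: tensor_scale_def fun_eq_iff algebra_simps)

lemma vector_space_times: "vector_space ((*) :: 'k::field \<Rightarrow> _)"
  by unfold_locales (auto simp: algebra_simps)

lemma sum_tensor_apply: "(\<Sum>i\<in>I. f i) A = (\<Sum>i\<in>I. f i A :: 'k::field)"
  by (induction I rule: infinite_finite_induct) (auto simp: zero_fun_def)

lemma multilinear_pure_tensor:
  assumes "vector_space (scl :: 'k::field \<Rightarrow> 'a::ab_group_add \<Rightarrow> 'a)"
  shows "multilinear_map scl tensor_scale N (pure_tensor scl N)"
proof -
  have "Vector_Spaces.linear scl tensor_scale (\<lambda>x. pure_tensor scl N (xs[i := x]))"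
    if "length xs = N" "i < N" for xs i
  proof -
    have lin: "Vector_Spaces.linear scl (*) (\<lambda>x. A (xs[i := x]))"
      if "multilinear_map scl (*) N A" for A
      using that \<open>length xs = N\<close> \<open>i < N\<close> by (auto simp: multilinear_map_def)
    note l = lin[unfolded Vector_Spaces.linear_iff]
    show ?thesis
      unfolding Vector_Spaces.linear_iff
      using assms vector_space_tensor_scale l
      by (auto simp: pure_tensor_def tensor_scale_def fun_eq_iff)
  qed
  then show ?thesis by (auto simp: multilinear_map_def)
qed

lemma pure_tensor_universal:
  fixes sclB :: "'k::field \<Rightarrow> 'b::ab_group_add \<Rightarrow> 'b"
  assumes B: "vector_space sclB" and T: "multilinear_map scl sclB N T"
    and z: "(\<Sum>i\<in>I. tensor_scale (c i) (pure_tensor scl N (xs i))) = 0"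
  shows "(\<Sum>i\<in>I. sclB (c i) (T (xs i))) = 0"
proof (rule ccontr)
  let ?w = "\<Sum>i\<in>I. sclB (c i) (T (xs i))"
  interpret B: vector_space sclB by fact
  interpret K: vector_space "(*) :: 'k \<Rightarrow> _" by (rule vector_space_times)
  interpret P: vector_space_pair sclB "(*) :: 'k \<Rightarrow> _" by unfold_locales
  assume "?w \<noteq> 0"
  then have "B.independent {?w}" by simp
  then obtain \<phi> where \<phi>: "Vector_Spaces.linear sclB (*) \<phi>" "\<phi> ?w = 1"
    using P.linear_independent_extend[of "{?w}" "\<lambda>_. 1"] by auto
  have "multilinear_map scl (*) N (\<phi> \<circ> T)"
    using T \<phi>(1) Vector_Spaces.linear_compose[of scl sclB _ "(*)" \<phi>]
    unfolding multilinear_map_def by (auto simp: o_def)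
  then have "(\<Sum>i\<in>I. c i * \<phi> (T (xs i))) = 0"
    using fun_cong[OF z, of "\<phi> \<circ> T"]
    by (simp add: sum_tensor_apply tensor_scale_def pure_tensor_def)
  moreover have "\<phi> ?w = (\<Sum>i\<in>I. c i * \<phi> (T (xs i)))"
    by (simp add: P.linear_sum[OF \<phi>(1)] P.linear_scale[OF \<phi>(1)])
  ultimately show False using \<phi>(2) by simp
qed


section \<open>Completion by Cauchy sequences\<close>

definition cauchy_seqs :: "'v::ab_group_add set \<Rightarrow> ('v \<Rightarrow> real) \<Rightarrow> (nat \<Rightarrow> 'v) set" where
  "cauchy_seqs V p =
    {u. range u \<subseteq> V \<and> (\<forall>e>0. \<exists>n0. \<forall>m\<ge>n0. \<forall>n\<ge>n0. p (u m - u n) < e)}"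

definition null_rel ::
  "'v::ab_group_add set \<Rightarrow> ('v \<Rightarrow> real) \<Rightarrow> ((nat \<Rightarrow> 'v) \<times> (nat \<Rightarrow> 'v)) set" where
  "null_rel V p =
    {(u, v). u \<in> cauchy_seqs V p \<and> v \<in> cauchy_seqs V p \<and> (\<lambda>n. p (u n - v n)) \<longlonglongrightarrow> 0}"

definition cauchy_completion :: "'v::ab_group_add set \<Rightarrow> ('v \<Rightarrow> real) \<Rightarrow> (nat \<Rightarrow> 'v) set set" where
  "cauchy_completion V p = cauchy_seqs V p // null_rel V p"

definition completion_embed ::
  "'v::ab_group_add set \<Rightarrow> ('v \<Rightarrow> real) \<Rightarrow> 'v \<Rightarrow> (nat \<Rightarrow> 'v) set" where
  "completion_embed V p z = null_rel V p `` {\<lambda>_. z}"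

definition completion_norm :: "('v::ab_group_add \<Rightarrow> real) \<Rightarrow> (nat \<Rightarrow> 'v) set \<Rightarrow> real" where
  "completion_norm p U = (THE r. \<forall>u\<in>U. (\<lambda>n. p (u n)) \<longlonglongrightarrow> r)"

text \<open>The value \<open>0\<close> outside the completion is what \<^const>\<open>Metric_space\<close> demands of a metric.\<close>

definition completion_dist ::
  "'v::ab_group_add set \<Rightarrow> ('v \<Rightarrow> real) \<Rightarrow> (nat \<Rightarrow> 'v) set \<Rightarrow> (nat \<Rightarrow> 'v) set \<Rightarrow> real" where
  "completion_dist V p U W =
    (if U \<in> cauchy_completion V p \<and> W \<in> cauchy_completion V p
     then THE r. \<forall>u\<in>U. \<forall>w\<in>W. (\<lambda>n. p (u n - w n)) \<longlonglongrightarrow> r else 0)"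

definition completion_topology ::
  "'v::ab_group_add set \<Rightarrow> ('v \<Rightarrow> real) \<Rightarrow> (nat \<Rightarrow> 'v) set topology" where
  "completion_topology V p = Metric_space.mtopology (cauchy_completion V p) (completion_dist V p)"

text \<open>
  The following facts show that the definite descriptions above are well defined, that the completion
  is a complete metric space, and that the embedding is isometric with dense range.
\<close>

locale seminorm_on =
  fixes V :: "'v::ab_group_add set" and p :: "'v \<Rightarrow> real"
  assumes zero_mem: "0 \<in> V"
    and diff_mem: "u \<in> V \<Longrightarrow> v \<in> V \<Longrightarrow> u - v \<in> V"
    and p_nonneg: "u \<in> V \<Longrightarrow> 0 \<le> p u"
    and p_zero: "p 0 = 0"
    and p_commute: "u \<in> V \<Longrightarrow> v \<in> V \<Longrightarrow> p (u - v) = p (v - u)"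
    and p_triangle: "u \<in> V \<Longrightarrow> v \<in> V \<Longrightarrow> p (u + v) \<le> p u + p v"
begin

lemma p_triangle3:
  assumes "u \<in> V" "v \<in> V" "w \<in> V"
  shows "p (u - w) \<le> p (u - v) + p (v - w)"
  using p_triangle[of "u - v" "v - w"] assms diff_mem by simp

lemma cauchy_memD: "u \<in> cauchy_seqs V p \<Longrightarrow> u n \<in> V"
  by (auto simp: cauchy_seqs_def)

lemma const_cauchy: "z \<in> V \<Longrightarrow> (\<lambda>_. z) \<in> cauchy_seqs V p"
  by (auto simp: cauchy_seqs_def p_zero)

lemma p_diff_convergent:
  assumes u: "u \<in> cauchy_seqs V p" and w: "w \<in> cauchy_seqs V p"
  shows "convergent (\<lambda>n. p (u n - w n))"
proof -
  have "Cauchy (\<lambda>n. p (u n - w n))"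
  proof (rule metric_CauchyI)
    fix e :: real assume "e > 0"
    then obtain n1 n2 where n: "\<forall>m\<ge>n1. \<forall>n\<ge>n1. p (u m - u n) < e / 2"
      "\<forall>m\<ge>n2. \<forall>n\<ge>n2. p (w m - w n) < e / 2"
      using u w unfolding cauchy_seqs_def by (smt (verit) half_gt_zero mem_Collect_eq)
    have "dist (p (u m - w m)) (p (u n - w n)) < e"
      if "m \<ge> max n1 n2" "n \<ge> max n1 n2" for m n
    proof -
      note V = cauchy_memD[OF u] cauchy_memD[OF w]
      have "p (u m - u n) < e / 2" "p (w m - w n) < e / 2" using n that by auto
      moreover have "p (u n - u m) = p (u m - u n)" "p (w n - w m) = p (w m - w n)"
        using p_commute V by auto
      moreover have "p (u m - w m) \<le> p (u m - u n) + p (u n - w m)"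
        "p (u n - w m) \<le> p (u n - w n) + p (w n - w m)"
        "p (u n - w n) \<le> p (u n - u m) + p (u m - w n)"
        "p (u m - w n) \<le> p (u m - w m) + p (w m - w n)"
        using p_triangle3 V by auto
      ultimately show ?thesis unfolding dist_real_def by linarith
    qed
    then show "\<exists>M. \<forall>m\<ge>M. \<forall>n\<ge>M. dist (p (u m - w m)) (p (u n - w n)) < e" by blast
  qed
  then show ?thesis by (simp add: Cauchy_convergent_iff)
qed

lemma null_relD:
  assumes "(u, v) \<in> null_rel V p"
  shows "u \<in> cauchy_seqs V p" "v \<in> cauchy_seqs V p" "(\<lambda>n. p (u n - v n)) \<longlonglongrightarrow> 0"
  using assms by (auto simp: null_rel_def)

lemma null_rel_sym: "(u, v) \<in> null_rel V p \<Longrightarrow> (v, u) \<in> null_rel V p"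
proof -
  assume a: "(u, v) \<in> null_rel V p"
  have "p (v n - u n) = p (u n - v n)" for n
    using p_commute cauchy_memD null_relD[OF a] by auto
  then show ?thesis using a by (auto simp: null_rel_def)
qed

lemma null_rel_trans:
  assumes "(u, v) \<in> null_rel V p" "(v, w) \<in> null_rel V p"
  shows "(u, w) \<in> null_rel V p"
proof -
  note D = null_relD[OF assms(1)] null_relD[OF assms(2)]
  have "(\<lambda>n. p (u n - v n) + p (v n - w n)) \<longlonglongrightarrow> 0"
    using tendsto_add[OF D(3) D(6)] by simp
  then have "(\<lambda>n. p (u n - w n)) \<longlonglongrightarrow> 0"
    by (rule tendsto_sandwich[rotated 3, where f="\<lambda>_. 0"])
      (use p_nonneg diff_mem cauchy_memD D p_triangle3 in \<open>auto intro!: always_eventually\<close>)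
  then show ?thesis using D by (auto simp: null_rel_def)
qed

lemma equiv_null_rel: "equiv (cauchy_seqs V p) (null_rel V p)"
proof (rule equivI)
  show "null_rel V p \<subseteq> cauchy_seqs V p \<times> cauchy_seqs V p" by (auto simp: null_rel_def)
  show "refl_on (cauchy_seqs V p) (null_rel V p)"
    by (auto simp: refl_on_def null_rel_def p_zero)
  show "sym (null_rel V p)" using null_rel_sym by (auto simp: sym_def)
  show "trans (null_rel V p)" using null_rel_trans by (auto simp: trans_def)
qed

lemma completion_memD: "U \<in> cauchy_completion V p \<Longrightarrow> u \<in> U \<Longrightarrow> u \<in> cauchy_seqs V p"
  unfolding cauchy_completion_def using in_quotient_imp_subset[OF equiv_null_rel] by blast

lemma completion_nonempty: "U \<in> cauchy_completion V p \<Longrightarrow> U \<noteq> {}"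
  unfolding cauchy_completion_def by (rule in_quotient_imp_non_empty[OF equiv_null_rel])

lemma completion_rel: "U \<in> cauchy_completion V p \<Longrightarrow> u \<in> U \<Longrightarrow> v \<in> U \<Longrightarrow> (u, v) \<in> null_rel V p"
  unfolding cauchy_completion_def using quotient_eq_iff[OF equiv_null_rel] by blast

lemma completion_closed: "U \<in> cauchy_completion V p \<Longrightarrow> u \<in> U \<Longrightarrow> (u, v) \<in> null_rel V p \<Longrightarrow> v \<in> U"
  unfolding cauchy_completion_def using in_quotient_imp_closed[OF equiv_null_rel] by blast

lemma class_mem_completion: "u \<in> cauchy_seqs V p \<Longrightarrow> null_rel V p `` {u} \<in> cauchy_completion V p"
  unfolding cauchy_completion_def by (rule quotientI)

lemma self_mem_class: "u \<in> cauchy_seqs V p \<Longrightarrow> u \<in> null_rel V p `` {u}"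
  using equiv_class_self[OF equiv_null_rel] by blast

lemma completion_dist_tendsto:
  assumes U: "U \<in> cauchy_completion V p" "u \<in> U" and W: "W \<in> cauchy_completion V p" "w \<in> W"
  shows "(\<lambda>n. p (u n - w n)) \<longlonglongrightarrow> completion_dist V p U W"
proof -
  obtain r where r: "(\<lambda>n. p (u n - w n)) \<longlonglongrightarrow> r"
    using p_diff_convergent completion_memD U W unfolding convergent_def by blast
  have all: "(\<lambda>n. p (u' n - w' n)) \<longlonglongrightarrow> r" if "u' \<in> U" "w' \<in> W" for u' w'
  proof -
    note D = null_relD[OF completion_rel[OF U that(1)]] null_relD[OF completion_rel[OF W that(2)]]
    note V = D(1,2,4,5)[THEN cauchy_memD]
    have "(\<lambda>n. p (u n - u' n) + p (w n - w' n)) \<longlonglongrightarrow> 0"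
      using tendsto_add[OF D(3) D(6)] by simp
    moreover have "norm (p (u' n - w' n) - p (u n - w n)) \<le> p (u n - u' n) + p (w n - w' n)" for n
    proof -
      have "p (u' n - u n) = p (u n - u' n)" "p (w' n - w n) = p (w n - w' n)"
        using p_commute V by auto
      moreover have "p (u n - w n) \<le> p (u n - u' n) + p (u' n - w n)"
        "p (u' n - w n) \<le> p (u' n - w' n) + p (w' n - w n)"
        "p (u' n - w' n) \<le> p (u' n - u n) + p (u n - w' n)"
        "p (u n - w' n) \<le> p (u n - w n) + p (w n - w' n)"
        using p_triangle3 V by auto
      ultimately show ?thesis unfolding real_norm_def by linarith
    qed
    ultimately have "(\<lambda>n. p (u' n - w' n) - p (u n - w n)) \<longlonglongrightarrow> 0"
      by (metis (no_types, lifting) Lim_null_comparison always_eventually)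
    from tendsto_add[OF this r] show ?thesis by simp
  qed
  have "completion_dist V p U W = r"
    unfolding completion_dist_def if_P[OF conjI[OF U(1) W(1)]]
  proof (rule the_equality)
    show "\<forall>u\<in>U. \<forall>w\<in>W. (\<lambda>n. p (u n - w n)) \<longlonglongrightarrow> r" using all by blast
  next
    fix r' assume "\<forall>u\<in>U. \<forall>w\<in>W. (\<lambda>n. p (u n - w n)) \<longlonglongrightarrow> r'"
    then have "(\<lambda>n. p (u n - w n)) \<longlonglongrightarrow> r'" using U(2) W(2) by blast
    from LIMSEQ_unique[OF this r] show "r' = r" .
  qed
  then show ?thesis using r by simp
qed

lemma completion_embed_mem: "z \<in> V \<Longrightarrow> completion_embed V p z \<in> cauchy_completion V p"
  unfolding completion_embed_def by (intro class_mem_completion const_cauchy)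

lemma const_mem_embed: "z \<in> V \<Longrightarrow> (\<lambda>_. z) \<in> completion_embed V p z"
  unfolding completion_embed_def by (intro self_mem_class const_cauchy)

lemma completion_norm_tendsto:
  assumes U: "U \<in> cauchy_completion V p" "u \<in> U"
  shows "(\<lambda>n. p (u n)) \<longlonglongrightarrow> completion_norm p U"
proof -
  let ?r = "completion_dist V p U (completion_embed V p 0)"
  have all: "(\<lambda>n. p (u' n)) \<longlonglongrightarrow> ?r" if "u' \<in> U" for u'
    using completion_dist_tendsto[OF U(1) that completion_embed_mem[OF zero_mem]
        const_mem_embed[OF zero_mem]] by simp
  have "completion_norm p U = ?r"
    unfolding completion_norm_def
  proof (rule the_equality)
    show "\<forall>u\<in>U. (\<lambda>n. p (u n)) \<longlonglongrightarrow> ?r" using all by blast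
  next
    fix r' assume "\<forall>u\<in>U. (\<lambda>n. p (u n)) \<longlonglongrightarrow> r'"
    then have "(\<lambda>n. p (u n)) \<longlonglongrightarrow> r'" using U(2) by blast
    from LIMSEQ_unique[OF this all[OF U(2)]] show "r' = ?r" .
  qed
  then show ?thesis using all U by simp
qed

lemma completion_norm_embed:
  assumes z: "z \<in> V"
  shows "completion_norm p (completion_embed V p z) = p z"
  using completion_norm_tendsto[OF completion_embed_mem[OF z] const_mem_embed[OF z]]
  by (simp add: LIMSEQ_const_iff)

lemma completion_dist_embed:
  assumes y: "y \<in> V" and z: "z \<in> V"
  shows "completion_dist V p (completion_embed V p y) (completion_embed V p z) = p (y - z)"
  using completion_dist_tendsto[OF completion_embed_mem[OF y] const_mem_embed[OF y]
      completion_embed_mem[OF z] const_mem_embed[OF z]]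
  by (simp add: LIMSEQ_const_iff)

lemma Metric_space_completion: "Metric_space (cauchy_completion V p) (completion_dist V p)"
proof
  have nonneg: "0 \<le> completion_dist V p U W"
    if UW: "U \<in> cauchy_completion V p" "W \<in> cauchy_completion V p" for U W
  proof -
    obtain u w where uw: "u \<in> U" "w \<in> W"
      using completion_nonempty[OF UW(1)] completion_nonempty[OF UW(2)] by blast
    have "0 \<le> p (u n - w n)" for n
      by (intro p_nonneg diff_mem cauchy_memD completion_memD[OF UW(1) uw(1)]
          completion_memD[OF UW(2) uw(2)])
    then show ?thesis
      using LIMSEQ_le_const[OF completion_dist_tendsto[OF UW(1) uw(1) UW(2) uw(2)]] by blast
  qed
  show "0 \<le> completion_dist V p U W" for U W
    by (cases "U \<in> cauchy_completion V p \<and> W \<in> cauchy_completion V p")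
      (use nonneg in blast, auto simp: completion_dist_def)
  have comm: "completion_dist V p U W = completion_dist V p W U"
    if UW: "U \<in> cauchy_completion V p" "W \<in> cauchy_completion V p" for U W
  proof -
    obtain u w where uw: "u \<in> U" "w \<in> W"
      using completion_nonempty[OF UW(1)] completion_nonempty[OF UW(2)] by blast
    have "p (u n - w n) = p (w n - u n)" for n
      by (intro p_commute cauchy_memD completion_memD[OF UW(1) uw(1)]
          completion_memD[OF UW(2) uw(2)])
    then show ?thesis
      using completion_dist_tendsto[OF UW(1) uw(1) UW(2) uw(2)]
        completion_dist_tendsto[OF UW(2) uw(2) UW(1) uw(1)] by (simp add: LIMSEQ_unique)
  qed
  show "completion_dist V p U W = completion_dist V p W U" for U W
    by (cases "U \<in> cauchy_completion V p \<and> W \<in> cauchy_completion V p")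
      (use comm in blast, auto simp: completion_dist_def)
  show "completion_dist V p U W = 0 \<longleftrightarrow> U = W"
    if UW: "U \<in> cauchy_completion V p" "W \<in> cauchy_completion V p" for U W
  proof -
    obtain u w where uw: "u \<in> U" "w \<in> W"
      using completion_nonempty[OF UW(1)] completion_nonempty[OF UW(2)] by blast
    note lim = completion_dist_tendsto[OF UW(1) uw(1) UW(2) uw(2)]
    note cs = completion_memD[OF UW(1) uw(1)] completion_memD[OF UW(2) uw(2)]
    have "completion_dist V p U W = 0 \<longleftrightarrow> (u, w) \<in> null_rel V p"
    proof
      assume "completion_dist V p U W = 0"
      then show "(u, w) \<in> null_rel V p" using lim cs by (simp add: null_rel_def)
    next
      assume "(u, w) \<in> null_rel V p"
      from LIMSEQ_unique[OF lim null_relD(3)[OF this]] show "completion_dist V p U W = 0" .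
    qed
    also have "\<dots> \<longleftrightarrow> U = W"
      using quotient_eq_iff[OF equiv_null_rel] UW uw unfolding cauchy_completion_def by blast
    finally show ?thesis .
  qed
  show "completion_dist V p U Y \<le> completion_dist V p U W + completion_dist V p W Y"
    if A: "U \<in> cauchy_completion V p" "W \<in> cauchy_completion V p" "Y \<in> cauchy_completion V p" for U W Y
  proof -
    obtain u w y where uw: "u \<in> U" "w \<in> W" "y \<in> Y"
      using completion_nonempty[OF A(1)] completion_nonempty[OF A(2)] completion_nonempty[OF A(3)]
      by blast
    have V: "u n \<in> V" "w n \<in> V" "y n \<in> V" for n
      by (auto intro: cauchy_memD completion_memD[OF A(1) uw(1)]
          completion_memD[OF A(2) uw(2)] completion_memD[OF A(3) uw(3)])
    have "\<exists>n0. \<forall>n\<ge>n0. p (u n - y n) \<le> p (u n - w n) + p (w n - y n)"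
      using p_triangle3[OF V(1,2,3)] by blast
    then show ?thesis
      by (rule LIMSEQ_le[OF completion_dist_tendsto[OF A(1) uw(1) A(3) uw(3)]
            tendsto_add[OF completion_dist_tendsto[OF A(1) uw(1) A(2) uw(2)]
              completion_dist_tendsto[OF A(2) uw(2) A(3) uw(3)]]])
  qed
qed

lemma completion_embed_approx:
  assumes U: "U \<in> cauchy_completion V p" and u: "u \<in> U"
  shows "(\<lambda>m. completion_dist V p U (completion_embed V p (u m))) \<longlonglongrightarrow> 0"
proof (rule LIMSEQ_I)
  fix e :: real assume "e > 0"
  note cu = completion_memD[OF U u]
  obtain n0 where n0: "\<forall>m\<ge>n0. \<forall>n\<ge>n0. p (u m - u n) < e / 2"
    using cu \<open>e > 0\<close> unfolding cauchy_seqs_def by (smt (verit) half_gt_zero mem_Collect_eq)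
  have "norm (completion_dist V p U (completion_embed V p (u m)) - 0) < e" if "m \<ge> n0" for m
  proof -
    note um = cauchy_memD[OF cu, of m]
    have "\<exists>n1. \<forall>n\<ge>n1. p (u n - u m) \<le> e / 2"
      using n0 that by (meson less_imp_le)
    then have "completion_dist V p U (completion_embed V p (u m)) \<le> e / 2"
      by (rule LIMSEQ_le_const2[OF completion_dist_tendsto[OF U u completion_embed_mem[OF um]
              const_mem_embed[OF um]]])
    then show ?thesis
      using \<open>e > 0\<close> Metric_space.nonneg[OF Metric_space_completion] by (simp add: abs_of_nonneg)
  qed
  then show "\<exists>no. \<forall>n\<ge>no. norm (completion_dist V p U (completion_embed V p (u n)) - 0) < e" by blast
qed

lemma mcomplete_completion: "Metric_space.mcomplete (cauchy_completion V p) (completion_dist V p)"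
proof -
  interpret M: Metric_space "cauchy_completion V p" "completion_dist V p" by (rule Metric_space_completion)
  have "\<exists>U. limitin M.mtopology \<sigma> U sequentially" if \<sigma>: "M.MCauchy \<sigma>" for \<sigma>
  proof -
    have \<sigma>C: "\<sigma> k \<in> cauchy_completion V p" for k using \<sigma> by (auto simp: M.MCauchy_def)
    have "\<exists>v\<in>V. completion_dist V p (\<sigma> k) (completion_embed V p v) < inverse (real (Suc k))" for k
    proof -
      obtain u where u: "u \<in> \<sigma> k" using completion_nonempty[OF \<sigma>C] by blast
      have "\<forall>\<^sub>F m in sequentially.
          completion_dist V p (\<sigma> k) (completion_embed V p (u m)) < inverse (real (Suc k))"
        by (rule order_tendstoD(2)[OF completion_embed_approx[OF \<sigma>C u]]) simp
      then show ?thesis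
        using cauchy_memD[OF completion_memD[OF \<sigma>C u]] unfolding eventually_sequentially
        by (meson order_refl)
    qed
    then obtain v where vV: "\<And>k. v k \<in> V"
      and v: "\<And>k. completion_dist V p (\<sigma> k) (completion_embed V p (v k)) < inverse (real (Suc k))"
      by metis
    let ?E = "\<lambda>k. completion_embed V p (v k)"
    have EC: "?E k \<in> cauchy_completion V p" for k using completion_embed_mem vV by blast
    have small: "\<exists>n0. \<forall>n\<ge>n0. inverse (real (Suc n)) < e" if "e > 0" for e :: real
      using order_tendstoD(2)[OF LIMSEQ_inverse_real_of_nat that]
      by (simp add: eventually_sequentially)
    have cv: "v \<in> cauchy_seqs V p"
    proof -
      have "\<exists>n0. \<forall>m\<ge>n0. \<forall>n\<ge>n0. p (v m - v n) < e" if "e > 0" for e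
      proof -
        obtain n1 where n1: "\<forall>n\<ge>n1. inverse (real (Suc n)) < e / 3"
          using small[of "e / 3"] \<open>e > 0\<close> by auto
        obtain n2 where n2: "\<forall>m n. n2 \<le> m \<longrightarrow> n2 \<le> n \<longrightarrow> completion_dist V p (\<sigma> m) (\<sigma> n) < e / 3"
          using \<sigma> \<open>e > 0\<close> unfolding M.MCauchy_def by (meson divide_pos_pos zero_less_numeral)
        have "p (v m - v n) < e" if "m \<ge> max n1 n2" "n \<ge> max n1 n2" for m n
        proof -
          have "completion_dist V p (?E m) (?E n) \<le>
              completion_dist V p (?E m) (\<sigma> m) + completion_dist V p (\<sigma> m) (?E n)"
            "completion_dist V p (\<sigma> m) (?E n) \<le>
              completion_dist V p (\<sigma> m) (\<sigma> n) + completion_dist V p (\<sigma> n) (?E n)"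
            using M.triangle EC \<sigma>C by auto
          moreover have "completion_dist V p (?E m) (\<sigma> m) < e / 3"
            "completion_dist V p (\<sigma> n) (?E n) < e / 3"
            using v[of m] v[of n] n1 that M.commute[of "?E m" "\<sigma> m"] by fastforce+
          moreover have "completion_dist V p (\<sigma> m) (\<sigma> n) < e / 3" using n2 that by auto
          ultimately show ?thesis using completion_dist_embed[OF vV vV, of m n] by linarith
        qed
        then show ?thesis by blast
      qed
      then show ?thesis using vV by (auto simp: cauchy_seqs_def)
    qed
    let ?U = "null_rel V p `` {v}"
    note UC = class_mem_completion[OF cv]
    have "(\<lambda>k. completion_dist V p (\<sigma> k) ?U) \<longlonglongrightarrow> 0"
    proof (rule tendsto_sandwich[where f="\<lambda>_. 0"])
      show "(\<lambda>k. inverse (real (Suc k)) + completion_dist V p ?U (?E k)) \<longlonglongrightarrow> 0"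
        using tendsto_add[OF LIMSEQ_inverse_real_of_nat
            completion_embed_approx[OF UC self_mem_class[OF cv]]] by simp
      have "completion_dist V p (\<sigma> k) ?U \<le> inverse (real (Suc k)) + completion_dist V p ?U (?E k)"
        for k
        using M.triangle[OF \<sigma>C EC UC, of k k] v[of k] M.commute[of ?U "?E k"] by simp
      then show "\<forall>\<^sub>F k in sequentially. completion_dist V p (\<sigma> k) ?U \<le>
          inverse (real (Suc k)) + completion_dist V p ?U (?E k)" by simp
    qed auto
    then show ?thesis
      unfolding M.limitin_metric_dist_null using UC \<sigma>C by (intro exI[of _ ?U]) simp
  qed
  then show ?thesis by (simp add: M.mcomplete_def)
qed

end


section \<open>The projective symmetric tensor product and norm attainment\<close>

definition proj_sym_tensor_product ::
  "('k::real_normed_field \<Rightarrow> 'a::real_normed_vector \<Rightarrow> 'a) \<Rightarrow> nat \<Rightarrow>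
    (nat \<Rightarrow> ('k, 'a) tensor) set set" where
  "proj_sym_tensor_product scl N = cauchy_completion (sym_tensors scl N) (sym_proj_norm scl N)"

definition proj_sym_topology ::
  "('k::real_normed_field \<Rightarrow> 'a::real_normed_vector \<Rightarrow> 'a) \<Rightarrow> nat \<Rightarrow>
    (nat \<Rightarrow> ('k, 'a) tensor) set topology" where
  "proj_sym_topology scl N =
    completion_topology (sym_tensors scl N) (sym_proj_norm scl N)"

text \<open>
  The projective symmetric norm is a seminorm on the symmetric tensors, so the facts on completions
  apply to it.
\<close>

definition sym_rep_costs ::
  "('k::real_normed_field \<Rightarrow> 'a::real_normed_vector \<Rightarrow> 'a) \<Rightarrow> nat \<Rightarrow> ('k, 'a) tensor \<Rightarrow> real set" where
  "sym_rep_costs scl N z =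
    {(\<Sum>k<n. norm (c k)) | (n::nat) c x.
       (\<forall>k<n. x k \<in> sphere 0 1) \<and>
       z = (\<Sum>k<n. tensor_scale (c k) (tensor_power scl N (x k)))}"

lemma sym_proj_norm_alt: "sym_proj_norm scl N z = Inf (sym_rep_costs scl N z)"
  by (simp add: sym_proj_norm_def sym_rep_costs_def)

lemma sym_rep_costs_nonneg: "a \<in> sym_rep_costs scl N z \<Longrightarrow> 0 \<le> a"
  by (auto simp: sym_rep_costs_def intro: sum_nonneg)

lemma sym_rep_costs_zero: "0 \<in> sym_rep_costs scl N 0"
  unfolding sym_rep_costs_def by (intro CollectI exI[of _ "0::nat"]) simp

lemma sym_rep_costs_unit:
  "norm x = 1 \<Longrightarrow> norm c \<in> sym_rep_costs scl N (tensor_scale c (tensor_power scl N x))"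
  unfolding sym_rep_costs_def
  by (intro CollectI exI[of _ "1::nat"] exI[of _ "\<lambda>_. c"] exI[of _ "\<lambda>_. x"]) simp

lemma sym_rep_costs_uminus:
  assumes "a \<in> sym_rep_costs scl N z"
  shows "a \<in> sym_rep_costs scl N (- z)"
proof -
  obtain n c x where a: "a = (\<Sum>k<n. norm (c k))" "\<forall>k<(n::nat). x k \<in> sphere 0 1"
    "z = (\<Sum>k<n. tensor_scale (c k) (tensor_power scl N (x k)))"
    using assms by (auto simp: sym_rep_costs_def)
  have "- z = (\<Sum>k<n. tensor_scale (- c k) (tensor_power scl N (x k)))"
    unfolding a(3) sum_negf[symmetric]
    by (intro sum.cong) (auto simp: tensor_scale_def fun_eq_iff)
  then show ?thesis
    unfolding sym_rep_costs_def using a(1,2)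
    by (intro CollectI exI[of _ n] exI[of _ "\<lambda>k. - c k"] exI[of _ x]) simp
qed

lemma sym_rep_costs_add:
  assumes "a \<in> sym_rep_costs scl N z" "b \<in> sym_rep_costs scl N w"
  shows "a + b \<in> sym_rep_costs scl N (z + w)"
proof -
  obtain n c x where a: "a = (\<Sum>k<n. norm (c k))" "\<forall>k<(n::nat). x k \<in> sphere 0 1"
    "z = (\<Sum>k<n. tensor_scale (c k) (tensor_power scl N (x k)))"
    using assms(1) by (auto simp: sym_rep_costs_def)
  obtain m d y where b: "b = (\<Sum>k<m. norm (d k))" "\<forall>k<(m::nat). y k \<in> sphere 0 1"
    "w = (\<Sum>k<m. tensor_scale (d k) (tensor_power scl N (y k)))"
    using assms(2) by (auto simp: sym_rep_costs_def)
  let ?e = "\<lambda>k. if k < n then c k else d (k - n)" and ?v = "\<lambda>k. if k < n then x k else y (k - n)"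
  have split: "(\<Sum>k<n + m. g k) = (\<Sum>k<n. g k) + (\<Sum>k<m. g (n + k))"
    for g :: "nat \<Rightarrow> 'z::comm_monoid_add"
    by (induction m) (auto simp: add.assoc)
  show ?thesis
    unfolding sym_rep_costs_def
  proof (intro CollectI exI[of _ "n + m"] exI[of _ ?e] exI[of _ ?v] conjI)
    show "a + b = (\<Sum>k<n + m. norm (?e k))" unfolding split a(1) b(1) by simp
    show "\<forall>k<n + m. ?v k \<in> sphere 0 1" using a(2) b(2) by auto
    show "z + w = (\<Sum>k<n + m. tensor_scale (?e k) (tensor_power scl N (?v k)))"
      unfolding split a(3) b(3) by simp
  qed
qed

lemma tensor_power_scale:
  assumes "vector_space (scl :: 'k::field \<Rightarrow> 'a::ab_group_add \<Rightarrow> 'a)"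
  shows "tensor_power scl N (scl c z) = tensor_scale (c ^ N) (tensor_power scl N z)"
proof -
  have "A (replicate N (scl c z)) = c ^ N * A (replicate N z)" if A: "multilinear_map scl (*) N A" for A
  proof -
    have "A (replicate m (scl c z) @ replicate (N - m) z) = c ^ m * A (replicate N z)" if "m \<le> N" for m
      using that
    proof (induction m)
      case (Suc m)
      let ?xs = "replicate m (scl c z) @ replicate (N - m) z"
      have N: "N - m = Suc (N - Suc m)" using Suc by simp
      have upd: "?xs[m := v] = replicate m (scl c z) @ v # replicate (N - Suc m) z" for v
        by (simp add: N list_update_append)
      have "Vector_Spaces.linear scl (*) (\<lambda>x. A (?xs[m := x]))"
        using A Suc unfolding multilinear_map_def by simp
      then have "A (?xs[m := scl c z]) = c * A (?xs[m := z])"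
        by (simp add: Vector_Spaces.linear_iff)
      moreover have "?xs[m := scl c z] = replicate (Suc m) (scl c z) @ replicate (N - Suc m) z"
        unfolding upd by (simp add: replicate_app_Cons_same)
      moreover have "?xs[m := z] = ?xs" unfolding upd by (simp add: N)
      ultimately show ?case using Suc by simp
    qed simp
    from this[of N] show ?thesis by simp
  qed
  then show ?thesis by (auto simp: tensor_power_def pure_tensor_def tensor_scale_def fun_eq_iff)
qed

lemma sym_rep_costs_nonempty:
  assumes "banach_space_over scl" "N \<ge> 1" "z \<in> sym_tensors scl N"
  shows "sym_rep_costs scl N z \<noteq> {}"
proof -
  interpret X: banach_space_over scl by fact
  interpret T: vector_space tensor_scale by (rule vector_space_tensor_scale)
  show ?thesis
    using assms(3) unfolding sym_tensors_def
  proof (induction rule: T.span_induct_alt)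
    case base
    then show ?case using sym_rep_costs_zero by blast
  next
    case (step c t y)
    then obtain w where t: "t = tensor_power scl N w" by blast
    have "\<exists>d. d \<in> sym_rep_costs scl N (tensor_scale c t)"
    proof (cases "w = 0")
      case True
      then have "t = tensor_scale (0 ^ N) (tensor_power scl N 0)"
        using t tensor_power_scale[OF X.vector_space_axioms, of N 0 0] by simp
      then have "tensor_scale c t = 0"
        using assms(2) by (simp add: power_0_left)
      then show ?thesis using sym_rep_costs_zero by metis
    next
      case False
      let ?u = "w /\<^sub>R norm w" and ?r = "of_real (norm w)"
      have "w = scl ?r ?u" using False by (simp add: X.scale_of_real)
      then have "tensor_scale c t = tensor_scale (c * ?r ^ N) (tensor_power scl N ?u)"
        unfolding t using tensor_power_scale[OF X.vector_space_axioms] by (metis T.scale_scale)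
      moreover have "norm ?u = 1" using False by simp
      ultimately show ?thesis using sym_rep_costs_unit by metis
    qed
    then show ?case using sym_rep_costs_add step.IH by (metis all_not_in_conv)
  qed
qed

lemma seminorm_on_sym_tensors:
  assumes "banach_space_over scl" "N \<ge> 1"
  shows "seminorm_on (sym_tensors scl N) (sym_proj_norm scl N)"
proof -
  interpret T: vector_space tensor_scale by (rule vector_space_tensor_scale)
  note ne = sym_rep_costs_nonempty[OF assms]
  have bdd: "bdd_below (sym_rep_costs scl N z)" for z
    using sym_rep_costs_nonneg by (rule bdd_belowI)
  show ?thesis
  proof
    show "0 \<in> sym_tensors scl N" unfolding sym_tensors_def by (rule T.span_zero)
    show "u - v \<in> sym_tensors scl N" if "u \<in> sym_tensors scl N" "v \<in> sym_tensors scl N" for u v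
      using that unfolding sym_tensors_def by (rule T.span_diff)
    show ge0: "0 \<le> sym_proj_norm scl N u" if "u \<in> sym_tensors scl N" for u
      unfolding sym_proj_norm_alt using ne[OF that] sym_rep_costs_nonneg by (intro cInf_greatest)
    show "sym_proj_norm scl N 0 = 0"
      using ge0[OF \<open>0 \<in> sym_tensors scl N\<close>] cInf_lower[OF sym_rep_costs_zero bdd]
      unfolding sym_proj_norm_alt by (rule antisym[rotated])
    show "sym_proj_norm scl N (u - v) = sym_proj_norm scl N (v - u)" for u v
    proof -
      have "sym_rep_costs scl N (u - v) = sym_rep_costs scl N (v - u)"
        using sym_rep_costs_uminus[of _ scl N "u - v"] sym_rep_costs_uminus[of _ scl N "v - u"]
        by auto
      then show ?thesis by (simp add: sym_proj_norm_alt)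
    qed
    show "sym_proj_norm scl N (u + v) \<le> sym_proj_norm scl N u + sym_proj_norm scl N v"
      if uv: "u \<in> sym_tensors scl N" "v \<in> sym_tensors scl N" for u v
    proof -
      have "sym_proj_norm scl N (u + v) - b \<le> a"
        if "a \<in> sym_rep_costs scl N u" "b \<in> sym_rep_costs scl N v" for a b
        using cInf_lower[OF sym_rep_costs_add[OF that] bdd] unfolding sym_proj_norm_alt by simp
      then have "sym_proj_norm scl N (u + v) - b \<le> sym_proj_norm scl N u"
        if "b \<in> sym_rep_costs scl N v" for b
        unfolding sym_proj_norm_alt[of scl N u] using ne[OF uv(1)] that by (intro cInf_greatest)
      then have "sym_proj_norm scl N (u + v) - sym_proj_norm scl N u \<le> b"
        if "b \<in> sym_rep_costs scl N v" for b
        using that by (simp add: algebra_simps)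
      then have "sym_proj_norm scl N (u + v) - sym_proj_norm scl N u \<le> sym_proj_norm scl N v"
        unfolding sym_proj_norm_alt[of scl N v] using ne[OF uv(2)] by (intro cInf_greatest)
      then show ?thesis by simp
    qed
  qed
qed

definition NA_sym ::
  "('k::real_normed_field \<Rightarrow> 'a::real_normed_vector \<Rightarrow> 'a) \<Rightarrow> nat \<Rightarrow>
    (nat \<Rightarrow> ('k, 'a) tensor) set set" where
  "NA_sym scl N =
    {z \<in> proj_sym_tensor_product scl N.
      \<exists>(c :: nat \<Rightarrow> 'k) (x :: nat \<Rightarrow> 'a).
        bounded (range c) \<and> range x \<subseteq> cball 0 1 \<and>
        limitin (proj_sym_topology scl N)
          (\<lambda>m. completion_embed (sym_tensors scl N) (sym_proj_norm scl N)
                 (\<Sum>n<m. tensor_scale (c n) (tensor_power scl N (x n))))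
          z sequentially \<and>
        (\<lambda>n. norm (c n)) sums completion_norm (sym_proj_norm scl N) z}"

end

theory Submission
  imports Defs "HOL-Computational_Algebra.Polynomial"
begin

text \<open>
  Approximate a tensor by \<open>u = \<Sum> c\<^sub>k x\<^sub>k\<^sup>N\<close> with unit vectors \<open>x\<^sub>k\<close>, and move the \<open>x\<^sub>k\<close> slightly into a
  finite-dimensional subspace \<open>M\<close> with a norm-one projection \<open>P\<close>; this changes \<open>u\<close> little because
  \<open>x \<mapsto> x\<^sup>N\<close> is continuous. For \<open>z\<close> in the span of the \<open>y\<^sup>N\<close> with \<open>y \<in> M\<close>, applying \<open>P\<close> to all vectors of a
  representation costs nothing, so the norm of \<open>z\<close> is computed by representations in the unit ball
  of \<open>M\<close>. That span is finite-dimensional, so by Caratheodory the number of terms may be bounded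
  independently of the representation, and compactness of the ball of \<open>M\<close> yields an optimal finite
  representation of \<open>z\<close>.
\<close>

section \<open>Finite-dimensional preliminaries\<close>

lemma conic_caratheodory:
  fixes scale :: "real \<Rightarrow> 'b::ab_group_add \<Rightarrow> 'b"
  assumes "vector_space scale" "finite F" "\<And>v. v \<in> F \<Longrightarrow> 0 \<le> t v"
  shows "\<exists>G t'. G \<subseteq> F \<and> \<not> module.dependent scale G \<and> (\<forall>v\<in>G. 0 \<le> t' v) \<and>
    sum t' G \<le> sum t F \<and> (\<Sum>v\<in>G. scale (t' v) v) = (\<Sum>v\<in>F. scale (t v) v)"
proof -
  interpret V: vector_space scale by fact
  show ?thesis
    using assms(2,3)
  proof (induction F arbitrary: t rule: finite_psubset_induct)
    case (psubset F)
    show ?case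
    proof (cases "V.dependent F")
      case False
      then show ?thesis using psubset.prems by (intro exI[of _ F] exI[of _ t]) auto
    next
      case True
      then obtain u0 where u0: "\<exists>v\<in>F. u0 v \<noteq> 0" "(\<Sum>v\<in>F. scale (u0 v) v) = 0"
        using V.dependent_finite[OF psubset.hyps] by auto
      define u where "u = (if sum u0 F \<ge> 0 then u0 else (\<lambda>v. - u0 v))"
      have u: "\<exists>v\<in>F. u v \<noteq> 0" "(\<Sum>v\<in>F. scale (u v) v) = 0" "sum u F \<ge> 0"
        using u0 by (auto simp: u_def sum_negf)
      have "\<exists>v\<in>F. u v > 0"
      proof (rule ccontr)
        assume "\<not> ?thesis"
        then have np: "\<forall>v\<in>F. u v \<le> 0" by (simp add: not_less)
        moreover have "sum u F = 0" using np u(3) sum_nonpos[of F u] by force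
        ultimately have "\<forall>v\<in>F. u v = 0" 
          using sum_nonneg_eq_0_iff[of F "\<lambda>v. - u v"] psubset.hyps by (simp add: sum_negf)
        then show False using u(1) by blast
      qed
      then have Pne: "{v\<in>F. u v > 0} \<noteq> {}" by blast
      have Pfin: "finite {v\<in>F. u v > 0}" using psubset.hyps by simp
      define s where "s = Min ((\<lambda>v. t v / u v) ` {v\<in>F. u v > 0})"
      have "s \<in> (\<lambda>v. t v / u v) ` {v\<in>F. u v > 0}"
        unfolding s_def using Pne Pfin by (intro Min_in) auto
      then obtain v0 where v0: "v0 \<in> F" "u v0 > 0" "s = t v0 / u v0" by blast
      have s0: "0 \<le> s" using v0 psubset.prems by simp
      define t1 where "t1 v = t v - s * u v" for v
      have t1: "0 \<le> t1 v" if "v \<in> F" for v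
      proof (cases "u v > 0")
        case True
        then have "s \<le> t v / u v" unfolding s_def using Pfin that by (intro Min_le) auto
        then show ?thesis using True by (simp add: t1_def pos_le_divide_eq)
      next
        case False
        then have "s * u v \<le> 0" using s0 by (simp add: mult_nonneg_nonpos)
        then show ?thesis using psubset.prems[OF that] by (simp add: t1_def)
      qed
      have t1v0: "t1 v0 = 0" using v0 by (simp add: t1_def)
      have "F - {v0} \<subset> F" using v0 by blast
      from psubset.IH[OF this, of t1] t1 obtain G t' where G: "G \<subseteq> F - {v0}" "\<not> V.dependent G"
        "\<forall>v\<in>G. 0 \<le> t' v" "sum t' G \<le> sum t1 (F - {v0})"
        "(\<Sum>v\<in>G. scale (t' v) v) = (\<Sum>v\<in>F - {v0}. scale (t1 v) v)" by auto
      have "sum t1 (F - {v0}) = sum t1 F"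
        using t1v0 v0 psubset.hyps by (simp add: sum.remove)
      also have "\<dots> = sum t F - s * sum u F"
        by (simp add: t1_def sum_subtractf sum_distrib_left)
      also have "\<dots> \<le> sum t F" using s0 u(3) by simp
      finally have "sum t' G \<le> sum t F" using G(4) by linarith
      moreover have "(\<Sum>v\<in>F - {v0}. scale (t1 v) v) = (\<Sum>v\<in>F. scale (t1 v) v)"
        using t1v0 v0 psubset.hyps by (simp add: sum.remove)
      moreover have "(\<Sum>v\<in>F. scale (t1 v) v) = (\<Sum>v\<in>F. scale (t v) v) - scale s (\<Sum>v\<in>F. scale (u v) v)"
        by (simp add: t1_def V.scale_left_diff_distrib sum_subtractf V.scale_sum_right)
      ultimately show ?thesis using G u(2) by (intro exI[of _ G] exI[of _ t']) auto
    qed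
  qed
qed

lemma finite_common_subseq:
  fixes Q :: "'i \<Rightarrow> (nat \<Rightarrow> nat) \<Rightarrow> bool"
  assumes "finite I"
    and ex: "\<And>i r. i \<in> I \<Longrightarrow> strict_mono r \<Longrightarrow> \<exists>r'::nat \<Rightarrow> nat. strict_mono r' \<and> Q i (r \<circ> r')"
    and sub: "\<And>i r (r'::nat \<Rightarrow> nat). i \<in> I \<Longrightarrow> Q i r \<Longrightarrow> strict_mono r' \<Longrightarrow> Q i (r \<circ> r')"
  shows "\<exists>r. strict_mono r \<and> (\<forall>i\<in>I. Q i r)"
  using assms
proof (induction I rule: finite_induct)
  case empty
  then show ?case by (auto simp: strict_mono_def intro: exI[of _ id])
next
  case (insert i I)
  then obtain r where r: "strict_mono r" "\<forall>i\<in>I. Q i r" by blast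
  obtain r' where r': "strict_mono r'" "Q i (r \<circ> r')" using insert.prems(1)[of i r] r(1) by blast
  then show ?case using r insert.prems(2) strict_mono_o[OF r(1) r'(1)] by blast
qed

context banach_space_over
begin

lemma tendsto_scl: "(a \<longlongrightarrow> \<alpha>) net \<Longrightarrow> ((\<lambda>j. scl (a j) v) \<longlongrightarrow> scl \<alpha> v) net"
proof -
  assume "(a \<longlongrightarrow> \<alpha>) net"
  then have "((\<lambda>j. norm (a j - \<alpha>) * norm v) \<longlongrightarrow> 0) net"
    by (intro tendsto_mult_left_zero) (simp add: tendsto_norm_zero_iff LIM_zero_iff)
  then have "((\<lambda>j. norm (scl (a j) v - scl \<alpha> v)) \<longlongrightarrow> 0) net"
    by (simp add: norm_scale scale_left_diff_distrib[symmetric])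
  then show ?thesis using tendsto_norm_zero_iff LIM_zero_iff by blast
qed

lemma span_bounded_subseq:
  fixes x :: "nat \<Rightarrow> 'a"
  assumes "finite B" "range x \<subseteq> span B" "bounded (range x)"
  shows "\<exists>r a \<alpha>. strict_mono r \<and> (\<forall>j. x (r j) = (\<Sum>b\<in>B. scl (a j b) b)) \<and>
    (\<forall>b\<in>B. (\<lambda>j. a j b) \<longlonglongrightarrow> \<alpha> b)"
  using assms
proof (induction B arbitrary: x rule: finite_induct)
  case empty
  then have "\<forall>j. x j = 0" by auto
  then show ?case by (intro exI[of _ id] exI) (auto simp: strict_mono_def)
next
  case (insert b B)
  show ?case
  proof (cases "b \<in> span B")
    case True
    then have "range x \<subseteq> span B" using insert.prems(1) by (simp add: span_redundant)
    from insert.IH[OF this insert.prems(2)] obtain r a \<alpha> where r: "strict_mono r"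
      "\<forall>j. x (r j) = (\<Sum>b\<in>B. scl (a j b) b)" "\<forall>b\<in>B. (\<lambda>j. a j b) \<longlonglongrightarrow> \<alpha> b" by blast
    have "(\<Sum>c\<in>B. scl (((a j)(b := 0)) c) c) = (\<Sum>c\<in>B. scl (a j c) c)" for j
      using insert.hyps by (intro sum.cong) auto
    then show ?thesis using r insert.hyps
      by (intro exI[of _ r] exI[of _ "\<lambda>j. (a j)(b := 0)"] exI[of _ "\<alpha>(b := 0)"]) auto
  next
    case False
    have "\<exists>d>0. \<forall>y\<in>span B. d \<le> norm (b - y)"
    proof (rule ccontr)
      assume "\<not> ?thesis"
      then have "\<exists>y\<in>span B. norm (b - y) < inverse (real (Suc n))" for n
        by (metis inverse_positive_iff_positive not_le of_nat_0_less_iff zero_less_Suc)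
      then obtain y where y: "\<And>n. y n \<in> span B" "\<And>n. norm (b - y n) < inverse (real (Suc n))"
        by metis
      have "(\<lambda>n. b - y n) \<longlonglongrightarrow> 0"
        by (rule Lim_null_comparison[OF _ LIMSEQ_inverse_real_of_nat])
          (use y(2) less_imp_le in \<open>auto intro!: always_eventually\<close>)
      from tendsto_diff[OF tendsto_const[of b] this] have yb: "y \<longlonglongrightarrow> b" by simp
      then have "bounded (range y)" using convergent_imp_bounded by blast
      then obtain r a \<alpha> where r: "strict_mono r"
        "\<forall>j. y (r j) = (\<Sum>b\<in>B. scl (a j b) b)" "\<forall>b\<in>B. (\<lambda>j. a j b) \<longlonglongrightarrow> \<alpha> b"
        using insert.IH[of y] y(1) by blast
      have "(\<lambda>j. y (r j)) \<longlonglongrightarrow> (\<Sum>b\<in>B. scl (\<alpha> b) b)"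
        using r by (simp add: tendsto_sum tendsto_scl)
      moreover have "(\<lambda>j. y (r j)) \<longlonglongrightarrow> b" using LIMSEQ_subseq_LIMSEQ[OF yb r(1)] by (simp add: o_def)
      ultimately have "b = (\<Sum>b\<in>B. scl (\<alpha> b) b)" using LIMSEQ_unique by blast
      also have "\<dots> \<in> span B" by (intro span_sum span_scale span_base)
      finally show False using False by simp
    qed
    then obtain d where d: "d > 0" "\<And>y. y \<in> span B \<Longrightarrow> d \<le> norm (b - y)" by blast
    have "\<exists>k. x n - scl k b \<in> span B" for n
      using insert.prems(1) span_breakdown_eq by blast
    then obtain k where k: "\<And>n. x n - scl (k n) b \<in> span B" by metis
    obtain C where C: "\<And>n. norm (x n) \<le> C" using insert.prems(2) by (auto simp: bounded_iff)
    have kb: "norm (k n) \<le> C / d" for n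
    proof (cases "k n = 0")
      case True
      have "0 \<le> C" using C[of n] norm_ge_zero[of "x n"] by linarith
      then show ?thesis using True d(1) by simp
    next
      case False
      let ?w = "scl (inverse (k n)) (x n - scl (k n) b)"
      have "- ?w \<in> span B" using k span_scale span_neg by blast
      from d(2)[OF this] have "d \<le> norm (b + ?w)" by simp
      also have "b + ?w = scl (inverse (k n)) (x n)"
        using False by (simp add: scale_right_diff_distrib)
      also have "norm \<dots> \<le> C / norm (k n)"
        using C[of n] by (simp add: norm_scale norm_inverse divide_inverse mult.commute mult_right_mono)
      finally show ?thesis using d(1) False by (simp add: field_simps)
    qed
    then have "bounded (range k)" by (auto simp: bounded_iff)
    then obtain \<kappa> r1 where r1: "strict_mono (r1 :: nat \<Rightarrow> nat)" "(k \<circ> r1) \<longlonglongrightarrow> \<kappa>"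
      using bounded_imp_convergent_subsequence by blast
    let ?y = "\<lambda>n. x (r1 n) - scl (k (r1 n)) b"
    have "norm (?y n) \<le> C + C / d * norm b" for n
      using norm_triangle_ineq4[of "x (r1 n)" "scl (k (r1 n)) b"] C[of "r1 n"]
        mult_right_mono[OF kb[of "r1 n"] norm_ge_zero[of b]] by (simp add: norm_scale)
    then have "bounded (range ?y)" by (auto simp: bounded_iff)
    then obtain r a \<alpha> where r: "strict_mono r"
      "\<forall>j. ?y (r j) = (\<Sum>b\<in>B. scl (a j b) b)" "\<forall>b\<in>B. (\<lambda>j. a j b) \<longlonglongrightarrow> \<alpha> b"
      using insert.IH[of ?y] k by blast
    let ?a = "\<lambda>j. (a j)(b := k (r1 (r j)))"
    have sumB: "(\<Sum>c\<in>B. scl (?a j c) c) = (\<Sum>c\<in>B. scl (a j c) c)" for j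
      using insert.hyps by (intro sum.cong) auto
    have "x (r1 (r j)) = (\<Sum>c\<in>insert b B. scl (?a j c) c)" for j
      using r(2)[rule_format, of j] sumB[of j] insert.hyps by (simp add: algebra_simps)
    moreover have "\<forall>c\<in>insert b B. (\<lambda>j. ?a j c) \<longlonglongrightarrow> (\<alpha>(b := \<kappa>)) c"
      using r(3) LIMSEQ_subseq_LIMSEQ[OF r1(2) r(1)] by (auto simp: o_def)
    ultimately show ?thesis using strict_mono_o[OF r1(1) r(1)]
      by (intro exI[of _ "r1 \<circ> r"] exI[of _ ?a] exI[of _ "\<alpha>(b := \<kappa>)"]) (auto simp: o_def)
  qed
qed

end

lemma multilinear_map_linear:
  assumes "multilinear_map scl sclB N T" "Suc (length xs + length ys) = N"
  shows "Vector_Spaces.linear scl sclB (\<lambda>v. T (xs @ v # ys))"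
proof -
  have "Vector_Spaces.linear scl sclB (\<lambda>v. T ((xs @ undefined # ys)[length xs := v]))"
    using assms unfolding multilinear_map_def by (metis length_append length_Cons add_Suc_right less_add_Suc1)
  then show ?thesis by simp
qed

lemma multilinear_power_tendsto:
  fixes A :: "'a::ab_group_add list \<Rightarrow> 'k::real_normed_field"
  assumes A: "multilinear_map scl (*) N A" and a: "\<And>b. b \<in> B \<Longrightarrow> (\<lambda>j. a j b) \<longlonglongrightarrow> \<alpha> b"
  shows "(\<lambda>j. A (replicate N (\<Sum>b\<in>B. scl (a j b) b))) \<longlonglongrightarrow> A (replicate N (\<Sum>b\<in>B. scl (\<alpha> b) b))"
proof -
  let ?y = "\<lambda>j. \<Sum>b\<in>B. scl (a j b) b" and ?v = "\<Sum>b\<in>B. scl (\<alpha> b) b"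
  have "(\<lambda>j. A (replicate m (?y j) @ zs)) \<longlonglongrightarrow> A (replicate m ?v @ zs)"
    if "m + length zs = N" for m zs
    using that
  proof (induction m arbitrary: zs)
    case (Suc m)
    have ex: "A (replicate m w @ (\<Sum>b\<in>B. scl (f b) b) # zs) =
        (\<Sum>b\<in>B. f b * A (replicate m w @ b # zs))" for w f
    proof -
      interpret L: Vector_Spaces.linear scl "(*)" "\<lambda>v. A (replicate m w @ v # zs)"
        using multilinear_map_linear[OF A] Suc.prems by simp
      show ?thesis by (simp add: L.sum L.scale)
    qed
    have "(\<lambda>j. \<Sum>b\<in>B. a j b * A (replicate m (?y j) @ b # zs)) \<longlonglongrightarrow>
        (\<Sum>b\<in>B. \<alpha> b * A (replicate m ?v @ b # zs))"
      by (intro tendsto_sum tendsto_mult a Suc.IH) (use Suc.prems in auto)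
    then show ?case
      by (simp add: ex[symmetric] replicate_app_Cons_same[symmetric] del: replicate_Suc)
        (simp add: ex[symmetric] replicate_app_Cons_same)
  qed simp
  from this[of N "[]"] show ?thesis by simp
qed

section \<open>Representations with vectors in a finite-dimensional subspace\<close>

lemma pure_tensor_mem_span:
  fixes scl :: "'k::field \<Rightarrow> 'a::ab_group_add \<Rightarrow> 'a"
  assumes X: "vector_space scl" and "set xs \<subseteq> module.span scl B" "length xs = N"
  shows "pure_tensor scl N xs \<in>
    module.span tensor_scale (pure_tensor scl N ` {ys. set ys \<subseteq> B \<and> length ys = N})"
proof -
  interpret X: vector_space scl by fact
  interpret T: vector_space "tensor_scale :: 'k \<Rightarrow> ('k, 'a) tensor \<Rightarrow> _"
    by (rule vector_space_tensor_scale)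
  let ?W = "T.span (pure_tensor scl N ` {ys. set ys \<subseteq> B \<and> length ys = N})"
  have "pure_tensor scl N (us @ ws) \<in> ?W"
    if "set us \<subseteq> X.span B" "set ws \<subseteq> B" "length us + length ws = N" for us ws
    using that
  proof (induction us arbitrary: ws rule: rev_induct)
    case Nil
    then show ?case by (intro T.span_base) auto
  next
    case (snoc u us)
    interpret L: Vector_Spaces.linear scl tensor_scale "\<lambda>v. pure_tensor scl N (us @ v # ws)"
      using multilinear_map_linear[OF multilinear_pure_tensor[OF X], of us ws N] snoc.prems by simp
    have "u \<in> X.span B" using snoc.prems by simp
    then have "pure_tensor scl N (us @ u # ws) \<in> ?W"
    proof (induction rule: X.span_induct_alt)
      case base
      show ?case unfolding L.zero by (rule T.span_zero)
    next
      case (step c b y)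
      have "pure_tensor scl N (us @ b # ws) \<in> ?W"
        using snoc.IH[of "b # ws"] snoc.prems step by simp
      then show ?case unfolding L.add L.scale using step by (intro T.span_add T.span_scale)
    qed
    then show ?case by simp
  qed
  from this[of xs "[]"] show ?thesis using assms by simp
qed

lemma vector_space_of_real_scale:
  fixes scale :: "'k::real_normed_field \<Rightarrow> 'b::ab_group_add \<Rightarrow> 'b"
  assumes "vector_space scale"
  shows "vector_space (\<lambda>r. scale (of_real r))"
proof -
  interpret vector_space scale by fact
  show ?thesis by unfold_locales (simp_all add: scale_right_distrib scale_left_distrib)
qed

lemma span_subset_real_span:
  fixes scale :: "'k::{real_normed_field, euclidean_space} \<Rightarrow> 'b::ab_group_add \<Rightarrow> 'b"
  assumes "vector_space scale"
  shows "module.span scale S \<subseteq>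
    module.span (\<lambda>r. scale (of_real r)) ((\<lambda>(e, s). scale e s) ` (Basis \<times> S))"
proof
  interpret V: vector_space scale by fact
  interpret R: vector_space "\<lambda>r. scale (of_real r)" by (rule vector_space_of_real_scale) fact
  let ?W = "R.span ((\<lambda>(e, s). scale e s) ` (Basis \<times> S))"
  have c: "scale c s \<in> ?W" if "s \<in> S" for c s
  proof -
    have "c = (\<Sum>e\<in>Basis. of_real (c \<bullet> e) * e)"
      using euclidean_representation[of c] by (simp add: scaleR_conv_of_real)
    then have "scale c s = (\<Sum>e\<in>Basis. scale (of_real (c \<bullet> e)) (scale e s))"
      by (metis (no_types, lifting) V.scale_scale V.scale_sum_left sum.cong)
    also have "\<dots> \<in> ?W"
      using that by (intro R.span_sum R.span_scale R.span_base) auto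
    finally show ?thesis .
  qed
  fix x assume "x \<in> V.span S"
  then show "x \<in> ?W"
    by (induction rule: V.span_induct_alt) (auto simp: R.span_zero intro: R.span_add c)
qed

text \<open>Absorbing the phases of the coefficients into the tensors makes the coefficients nonnegative, so that
  the real conic form of Caratheodory applies; the zero vector only pads the list to length \<open>D\<close>.\<close>

lemma sym_rep_bounded_length:
  fixes scl :: "'k::{real_normed_field, euclidean_space} \<Rightarrow> 'a::ab_group_add \<Rightarrow> 'a"
  assumes X: "vector_space scl" and B: "finite B"
  shows "\<exists>D::nat. \<forall>(n::nat) c y. y ` {..<n} \<subseteq> module.span scl B \<longrightarrow>
    (\<exists>c' y'. y' ` {..<D} \<subseteq> insert 0 (y ` {..<n}) \<and>
      (\<Sum>k<D. norm (c' k)) \<le> (\<Sum>k<n. norm (c k)) \<and>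
      (\<Sum>k<D. tensor_scale (c' k) (tensor_power scl N (y' k))) =
      (\<Sum>k<n. tensor_scale (c k) (tensor_power scl N (y k))))"
proof -
  interpret X: vector_space scl by fact
  interpret T: vector_space "tensor_scale :: 'k \<Rightarrow> ('k, 'a) tensor \<Rightarrow> _"
    by (rule vector_space_tensor_scale)
  let ?R = "\<lambda>r. tensor_scale (of_real r :: 'k) :: ('k, 'a) tensor \<Rightarrow> _"
  have Rvs: "vector_space ?R"
    by (rule vector_space_of_real_scale[OF vector_space_tensor_scale])
  interpret R: vector_space ?R by fact
  let ?S = "pure_tensor scl N ` {ys. set ys \<subseteq> B \<and> length ys = N}"
  let ?S' = "(\<lambda>(e, s). tensor_scale e s) ` (Basis \<times> ?S)"
  have fin: "finite ?S'" using finite_lists_length_eq[OF B] by simp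
  show ?thesis
  proof (intro exI[of _ "card ?S'"] allI impI)
    fix n :: nat and c :: "nat \<Rightarrow> 'k" and y
    assume y: "y ` {..<n} \<subseteq> X.span B"
    define v where "v k = tensor_scale (sgn (c k)) (tensor_power scl N (y k))" for k
    define F where "F = v ` {..<n}"
    define t where "t w = (\<Sum>k | k \<in> {..<n} \<and> v k = w. norm (c k))" for w
    have cv: "tensor_scale (c k) (tensor_power scl N (y k)) = ?R (norm (c k)) (v k)" for k
    proof -
      have "of_real (norm (c k)) * sgn (c k) = c k"
        by (cases "c k = 0") (auto simp: sgn_div_norm scaleR_conv_of_real)
      then show ?thesis unfolding v_def T.scale_scale by simp
    qed
    have sumF: "sum t F = (\<Sum>k<n. norm (c k))"
      unfolding t_def F_def by (rule sum.image_gen[symmetric]) simp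
    have "(\<Sum>w\<in>F. ?R (t w) w) = (\<Sum>w\<in>F. \<Sum>k | k \<in> {..<n} \<and> v k = w. ?R (norm (c k)) (v k))"
      unfolding t_def of_real_sum T.scale_sum_left by (intro sum.cong) auto
    also have "\<dots> = (\<Sum>k<n. ?R (norm (c k)) (v k))"
      unfolding F_def by (rule sum.image_gen[symmetric]) simp
    finally have sumv: "(\<Sum>w\<in>F. ?R (t w) w) = (\<Sum>k<n. tensor_scale (c k) (tensor_power scl N (y k)))"
      unfolding cv .
    have t0: "0 \<le> t w" for w unfolding t_def by (intro sum_nonneg) simp
    from conic_caratheodory[of ?R F t, OF Rvs _ t0]
    obtain G t' where G: "G \<subseteq> F" "R.independent G" "\<forall>w\<in>G. 0 \<le> t' w" "sum t' G \<le> sum t F"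
      "(\<Sum>w\<in>G. ?R (t' w) w) = (\<Sum>w\<in>F. ?R (t w) w)" unfolding F_def by auto
    have "F \<subseteq> T.span ?S"
    proof
      fix w assume "w \<in> F"
      then obtain k where "k < n" "w = v k" unfolding F_def by auto
      moreover have "tensor_power scl N (y k) \<in> T.span ?S"
        unfolding tensor_power_def using y \<open>k < n\<close> by (intro pure_tensor_mem_span[OF X]) auto
      ultimately show "w \<in> T.span ?S" unfolding v_def by (simp add: T.span_scale)
    qed
    also have "\<dots> \<subseteq> R.span ?S'" by (rule span_subset_real_span[OF vector_space_tensor_scale])
    finally have "G \<subseteq> R.span ?S'" using G(1) by blast
    from R.independent_span_bound[OF fin G(2) this]
    have card: "finite G" "card G \<le> card ?S'" by auto
    obtain h where h: "bij_betw h {..<card G} G"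
      using ex_bij_betw_nat_finite[OF card(1)] by (auto simp: lessThan_atLeast0)
    have "\<exists>k<n. w = v k" if "w \<in> G" for w using that G(1) unfolding F_def by auto
    then obtain \<kappa> where \<kappa>: "\<And>w. w \<in> G \<Longrightarrow> \<kappa> w < n" "\<And>w. w \<in> G \<Longrightarrow> w = v (\<kappa> w)" by metis
    define c' where "c' i = (if i < card G then of_real (t' (h i)) * sgn (c (\<kappa> (h i))) else 0)" for i
    define y' where "y' i = (if i < card G then y (\<kappa> (h i)) else 0)" for i
    have hG: "h i \<in> G" if "i < card G" for i using h that by (auto simp: bij_betw_def)
    have "y' ` {..<card ?S'} \<subseteq> insert 0 (y ` {..<n})"
      using hG \<kappa>(1) by (auto simp: y'_def)
    moreover have "(\<Sum>i<card ?S'. norm (c' i)) \<le> (\<Sum>k<n. norm (c k))"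
    proof -
      have "(\<Sum>i<card ?S'. norm (c' i)) = (\<Sum>i<card G. norm (c' i))"
        using card(2) by (intro sum.mono_neutral_right) (auto simp: c'_def)
      also have "\<dots> \<le> (\<Sum>i<card G. t' (h i))"
        using G(3) hG by (intro sum_mono) (auto simp: c'_def norm_mult norm_sgn)
      also have "\<dots> = sum t' G" by (rule sum.reindex_bij_betw[OF h])
      finally show ?thesis using G(4) sumF by linarith
    qed
    moreover have "(\<Sum>i<card ?S'. tensor_scale (c' i) (tensor_power scl N (y' i))) =
        (\<Sum>k<n. tensor_scale (c k) (tensor_power scl N (y k)))"
    proof -
      have "(\<Sum>i<card ?S'. tensor_scale (c' i) (tensor_power scl N (y' i))) =
          (\<Sum>i<card G. tensor_scale (c' i) (tensor_power scl N (y' i)))"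
        using card(2) by (intro sum.mono_neutral_right) (auto simp: c'_def)
      also have "\<dots> = (\<Sum>i<card G. ?R (t' (h i)) (h i))"
      proof (intro sum.cong refl)
        fix i assume "i \<in> {..<card G}"
        then have i: "i < card G" by simp
        have "tensor_scale (c' i) (tensor_power scl N (y' i)) = ?R (t' (h i)) (v (\<kappa> (h i)))"
          using i by (simp add: c'_def y'_def v_def)
        then show "tensor_scale (c' i) (tensor_power scl N (y' i)) = ?R (t' (h i)) (h i)"
          using \<kappa>(2)[OF hG[OF i]] by simp
      qed
      also have "\<dots> = (\<Sum>w\<in>G. ?R (t' w) w)" by (rule sum.reindex_bij_betw[OF h])
      finally show ?thesis using G(5) sumv by simp
    qed
    ultimately show "\<exists>c' y'. y' ` {..<card ?S'} \<subseteq> insert 0 (y ` {..<n}) \<and>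
      (\<Sum>k<card ?S'. norm (c' k)) \<le> (\<Sum>k<n. norm (c k)) \<and>
      (\<Sum>k<card ?S'. tensor_scale (c' k) (tensor_power scl N (y' k))) =
      (\<Sum>k<n. tensor_scale (c k) (tensor_power scl N (y k)))" by blast
  qed
qed

text \<open>Evaluate the hypothesis at the form \<open>A \<circ> P\<close>.\<close>

lemma sym_tensor_project:
  fixes scl :: "'k::field \<Rightarrow> 'a::ab_group_add \<Rightarrow> 'a"
  assumes P: "Vector_Spaces.linear scl scl P" and d: "\<And>k. k \<in> J \<Longrightarrow> P (w k) = w k"
    and eq: "(\<Sum>k\<in>J. tensor_scale (d k) (tensor_power scl N (w k))) =
      (\<Sum>k\<in>I. tensor_scale (c k) (tensor_power scl N (x k)))"
  shows "(\<Sum>k\<in>J. tensor_scale (d k) (tensor_power scl N (w k))) =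
      (\<Sum>k\<in>I. tensor_scale (c k) (tensor_power scl N (P (x k))))"
proof
  fix A :: "'a list \<Rightarrow> 'k"
  show "(\<Sum>k\<in>J. tensor_scale (d k) (tensor_power scl N (w k))) A =
      (\<Sum>k\<in>I. tensor_scale (c k) (tensor_power scl N (P (x k)))) A"
  proof (cases "multilinear_map scl (*) N A")
    case True
    have "multilinear_map scl (*) N (\<lambda>xs. A (map P xs))"
      unfolding multilinear_map_def
    proof (intro allI impI)
      fix xs :: "'a list" and i assume "length xs = N" "i < N"
      then have "Vector_Spaces.linear scl (*) (\<lambda>v. A ((map P xs)[i := v]))"
        using True by (simp add: multilinear_map_def)
      from Vector_Spaces.linear_compose[OF P this]
      show "Vector_Spaces.linear scl (*) (\<lambda>v. A (map P (xs[i := v])))"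
        by (simp add: o_def map_update)
    qed
    then show ?thesis using fun_cong[OF eq, of "\<lambda>xs. A (map P xs)"] True
      by (simp add: sum_tensor_apply tensor_scale_def tensor_power_def pure_tensor_def d)
  next
    case False
    then show ?thesis
      by (simp add: sum_tensor_apply tensor_scale_def tensor_power_def pure_tensor_def)
  qed
qed

section \<open>Continuity of tensor powers\<close>

lemma multilinear_power_poly:
  fixes scl :: "'k::field \<Rightarrow> 'a::ab_group_add \<Rightarrow> 'a"
  assumes A: "multilinear_map scl (*) N A"
  shows "\<exists>q. degree q \<le> N \<and> (\<forall>t. A (replicate N (x + scl t u)) = poly q t)"
proof -
  have "\<exists>q. degree q \<le> m \<and> (\<forall>t. A (replicate m (x + scl t u) @ zs) = poly q t)"
    if "m + length zs = N" for m zs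
    using that
  proof (induction m arbitrary: zs)
    case 0
    then show ?case by (intro exI[of _ "[:A zs:]"]) simp
  next
    case (Suc m)
    obtain q1 where q1: "degree q1 \<le> m" "\<And>t. A (replicate m (x + scl t u) @ x # zs) = poly q1 t"
      using Suc.IH[of "x # zs"] Suc.prems by auto
    obtain q2 where q2: "degree q2 \<le> m" "\<And>t. A (replicate m (x + scl t u) @ u # zs) = poly q2 t"
      using Suc.IH[of "u # zs"] Suc.prems by auto
    have "A (replicate (Suc m) (x + scl t u) @ zs) = poly (q1 + pCons 0 q2) t" for t
    proof -
      interpret L: Vector_Spaces.linear scl "(*)" "\<lambda>v. A (replicate m (x + scl t u) @ v # zs)"
        using multilinear_map_linear[OF A] Suc.prems by simp
      have "A (replicate m (x + scl t u) @ (x + scl t u) # zs) = poly (q1 + pCons 0 q2) t"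
        by (simp add: L.add L.scale q1 q2)
      then show ?thesis by (simp add: replicate_app_Cons_same)
    qed
    moreover have "degree (q1 + pCons 0 q2) \<le> Suc m"
      using q1(1) q2(1) degree_pCons_le[of 0 q2] by (intro degree_add_le) linarith+
    ultimately show ?case by blast
  qed
  from this[of N "[]"] show ?thesis by simp
qed

lemma lagrange_interpolation:
  "\<exists>L :: nat \<Rightarrow> 'k::field_char_0 poly. \<forall>q. degree q \<le> N \<longrightarrow>
    (\<forall>t. poly q t = (\<Sum>j\<le>N. poly (L j) t * poly q (of_nat j)))"
proof -
  define M :: "nat \<Rightarrow> 'k poly" where "M j = (\<Prod>i\<in>{..N} - {j}. [:- of_nat i, 1:])" for j
  define L where "L j = smult (inverse (poly (M j) (of_nat j))) (M j)" for j
  have Mj: "poly (M j) (of_nat i) = 0" if "i \<le> N" "i \<noteq> j" for i j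
    using that by (auto simp: M_def poly_prod)
  have Mjj: "poly (M j) (of_nat j) \<noteq> 0" for j by (auto simp: M_def poly_prod)
  have Lij: "poly (L j) (of_nat i) = (if i = j then 1 else 0)" if "i \<le> N" for i j
    using Mj[OF that] Mjj by (simp add: L_def)
  have degL: "degree (L j) \<le> N" if "j \<le> N" for j
  proof -
    have "degree (M j) \<le> (\<Sum>i\<in>{..N} - {j}. degree [:- of_nat i, 1 :: 'k:])"
      unfolding M_def using degree_prod_sum_le[of "{..N} - {j}" "\<lambda>i. [:- of_nat i, 1 :: 'k:]"]
      by (simp add: o_def)
    also have "\<dots> = N" using that by simp
    finally show ?thesis unfolding L_def using degree_smult_le order_trans by blast
  qed
  have "poly q t = (\<Sum>j\<le>N. poly (L j) t * poly q (of_nat j))" if "degree q \<le> N" for q t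
  proof -
    define s where "s = (\<Sum>j\<le>N. smult (poly q (of_nat j)) (L j))"
    have "degree s \<le> N"
      unfolding s_def using degL degree_smult_le order_trans by (intro degree_sum_le) (simp, blast)
    have "q = s"
    proof (rule poly_eqI_degree)
      show "poly q x = poly s x" if "x \<in> of_nat ` {..N}" for x
      proof -
        from that obtain i where i: "i \<le> N" "x = of_nat i" by auto
        have "poly s x = (\<Sum>j\<le>N. if j = i then poly q (of_nat j) else 0)"
          unfolding s_def poly_sum using i Lij by (intro sum.cong) auto
        then show ?thesis using i by simp
      qed
      have "card (of_nat ` {..N} :: 'k set) = Suc N"
        by (subst card_image) (auto simp: inj_on_def)
      then show "degree q < card (of_nat ` {..N} :: 'k set)" "degree s < card (of_nat ` {..N} :: 'k set)"
        using \<open>degree q \<le> N\<close> \<open>degree s \<le> N\<close> by simp_all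
    qed
    then have "poly q t = poly s t" by simp
    then show ?thesis unfolding s_def by (simp add: poly_sum mult.commute)
  qed
  then show ?thesis by blast
qed

context banach_space_over
begin

lemma tensor_power_mem: "tensor_scale c (tensor_power scl N x) \<in> sym_tensors scl N"
proof -
  interpret T: vector_space "tensor_scale :: 'k \<Rightarrow> ('k, 'a) tensor \<Rightarrow> _"
    by (rule vector_space_tensor_scale)
  show ?thesis unfolding sym_tensors_def by (intro T.span_scale T.span_base) simp
qed

lemma sum_tensor_power_mem:
  "(\<Sum>k\<in>I. tensor_scale (c k) (tensor_power scl N (x k))) \<in> sym_tensors scl N"
proof -
  interpret T: vector_space "tensor_scale :: 'k \<Rightarrow> ('k, 'a) tensor \<Rightarrow> _"
    by (rule vector_space_tensor_scale)
  show ?thesis using tensor_power_mem unfolding sym_tensors_def by (intro T.span_sum)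
qed

lemma sym_proj_norm_power_le:
  assumes N: "N \<ge> 1"
  shows "sym_proj_norm scl N (tensor_scale c (tensor_power scl N x)) \<le> norm c * norm x ^ N"
proof -
  interpret T: vector_space "tensor_scale :: 'k \<Rightarrow> ('k, 'a) tensor \<Rightarrow> _"
    by (rule vector_space_tensor_scale)
  have "norm c * norm x ^ N \<in> sym_rep_costs scl N (tensor_scale c (tensor_power scl N x))"
  proof (cases "x = 0")
    case True
    then have "tensor_power scl N x = tensor_scale (0 ^ N) (tensor_power scl N 0)"
      using tensor_power_scale[OF vector_space_axioms, of N 0 0] by simp
    then have "tensor_power scl N x = 0" using N by (simp only: power_0_left T.scale_zero_left) simp
    then have "tensor_scale c (tensor_power scl N x) = 0" by (simp only: T.scale_zero_right)
    moreover have "norm c * norm x ^ N = 0" using True N by simp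
    ultimately show ?thesis using sym_rep_costs_zero by metis
  next
    case False
    let ?u = "x /\<^sub>R norm x" and ?r = "of_real (norm x) :: 'k"
    have x: "x = scl ?r ?u" using False by (simp add: scale_of_real)
    have "tensor_power scl N x = tensor_scale (?r ^ N) (tensor_power scl N ?u)"
      by (subst x) (rule tensor_power_scale[OF vector_space_axioms])
    then have "tensor_scale c (tensor_power scl N x) = tensor_scale (c * ?r ^ N) (tensor_power scl N ?u)"
      by simp
    moreover have "norm ?u = 1" using False by simp
    ultimately show ?thesis
      using sym_rep_costs_unit[of ?u "c * ?r ^ N" scl N] by (simp add: norm_mult norm_power)
  qed
  then show ?thesis
    unfolding sym_proj_norm_alt using sym_rep_costs_nonneg
    by (intro cInf_lower bdd_belowI)
qed

lemma sym_proj_norm_sum_le: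
  assumes N: "N \<ge> 1" and "finite I" and f: "\<And>i. i \<in> I \<Longrightarrow> f i \<in> sym_tensors scl N"
  shows "sym_proj_norm scl N (\<Sum>i\<in>I. f i) \<le> (\<Sum>i\<in>I. sym_proj_norm scl N (f i))"
proof -
  interpret S: seminorm_on "sym_tensors scl N" "sym_proj_norm scl N"
    using seminorm_on_sym_tensors[OF banach_space_over_axioms N] .
  interpret T: vector_space "tensor_scale :: 'k \<Rightarrow> ('k, 'a) tensor \<Rightarrow> _"
    by (rule vector_space_tensor_scale)
  show ?thesis
    using assms(2,3)
  proof (induction I rule: finite_induct)
    case empty
    show ?case unfolding sum.empty S.p_zero by simp
  next
    case (insert i I)
    have "sum f I \<in> sym_tensors scl N"
      using insert.prems unfolding sym_tensors_def by (intro T.span_sum) simp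
    then have "sym_proj_norm scl N (f i + sum f I) \<le> sym_proj_norm scl N (f i) + sym_proj_norm scl N (sum f I)"
      using insert.prems by (intro S.p_triangle) auto
    also have "\<dots> \<le> sym_proj_norm scl N (f i) + (\<Sum>i\<in>I. sym_proj_norm scl N (f i))"
      using insert by simp
    finally show ?case unfolding sum.insert[OF insert.hyps] .
  qed
qed

lemma sym_proj_norm_rep_le:
  assumes N: "N \<ge> 1" and "finite I" and x: "\<And>i. i \<in> I \<Longrightarrow> norm (x i) \<le> 1"
  shows "sym_proj_norm scl N (\<Sum>i\<in>I. tensor_scale (c i) (tensor_power scl N (x i))) \<le> (\<Sum>i\<in>I. norm (c i))"
proof -
  have "sym_proj_norm scl N (tensor_scale (c i) (tensor_power scl N (x i))) \<le> norm (c i)" if "i \<in> I" for i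
  proof -
    have "norm (c i) * norm (x i) ^ N \<le> norm (c i) * 1"
      using x[OF that] by (intro mult_left_mono) (simp_all add: power_le_one)
    then show ?thesis using sym_proj_norm_power_le[OF N, of "c i" "x i"] by simp
  qed
  then have "(\<Sum>i\<in>I. sym_proj_norm scl N (tensor_scale (c i) (tensor_power scl N (x i)))) \<le> (\<Sum>i\<in>I. norm (c i))"
    by (rule sum_mono)
  then show ?thesis
    using sym_proj_norm_sum_le[OF N \<open>finite I\<close>, of "\<lambda>i. tensor_scale (c i) (tensor_power scl N (x i))"]
      tensor_power_mem by fastforce
qed

text \<open>Each evaluation of \<open>(x + t u)\<^sup>N\<close> is a polynomial in \<open>t\<close> of degree at most \<open>N\<close>. Lagrange interpolation at
  \<open>0, \<dots>, N\<close> hence writes \<open>(x + t u)\<^sup>N - x\<^sup>N\<close> as a combination of the boundedly many powers \<open>(x + j u)\<^sup>N\<close>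
  whose coefficients vanish as \<open>t \<rightarrow> 0\<close>.\<close>

lemma tensor_power_continuous:
  fixes N :: nat
  assumes N: "N \<ge> 1" and \<epsilon>: "\<epsilon> > 0"
  shows "\<exists>\<delta>>0. \<forall>x y. norm x = 1 \<longrightarrow> norm (x - y) < \<delta> \<longrightarrow>
    sym_proj_norm scl N (tensor_power scl N x - tensor_power scl N y) \<le> \<epsilon>"
proof -
  interpret S: seminorm_on "sym_tensors scl N" "sym_proj_norm scl N"
    using seminorm_on_sym_tensors[OF banach_space_over_axioms N] .
  obtain L :: "nat \<Rightarrow> 'k poly" where L: "\<And>q t. degree q \<le> N \<Longrightarrow>
      poly q t = (\<Sum>j\<le>N. poly (L j) t * poly q (of_nat j))"
    using lagrange_interpolation[of N] by blast
  have diff: "tensor_power scl N (x + scl t u) - tensor_power scl N x =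
      (\<Sum>j\<le>N. tensor_scale (poly (L j) t - poly (L j) 0) (tensor_power scl N (x + scl (of_nat j) u)))"
    for x u t
  proof
    fix A :: "'a list \<Rightarrow> 'k"
    show "(tensor_power scl N (x + scl t u) - tensor_power scl N x) A =
      (\<Sum>j\<le>N. tensor_scale (poly (L j) t - poly (L j) 0) (tensor_power scl N (x + scl (of_nat j) u))) A"
    proof (cases "multilinear_map scl (*) N A")
      case True
      then obtain q where q: "degree q \<le> N" "\<And>t. A (replicate N (x + scl t u)) = poly q t"
        using multilinear_power_poly by blast
      show ?thesis
        using True q(2)[of 0] L[OF q(1), of t] L[OF q(1), of 0]
        by (simp add: sum_tensor_apply tensor_scale_def tensor_power_def pure_tensor_def q(2)
            left_diff_distrib sum_subtractf)
    next
      case False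
      then show ?thesis
        by (simp add: sum_tensor_apply tensor_scale_def tensor_power_def pure_tensor_def)
    qed
  qed
  define g where "g t = (\<Sum>j\<le>N. norm (poly (L j) (of_real t) - poly (L j) 0) * (1 + real j) ^ N)" for t :: real
  have "g \<midarrow>0\<rightarrow> g 0"
    unfolding g_def by (intro tendsto_intros isCont_tendsto_compose[OF poly_isCont])
  moreover have "g 0 = 0" by (simp add: g_def)
  ultimately obtain \<delta> where \<delta>: "\<delta> > 0" "\<And>t. t \<noteq> 0 \<Longrightarrow> \<bar>t\<bar> < \<delta> \<Longrightarrow> \<bar>g t\<bar> < \<epsilon>"
    using LIM_D[of g 0 0 \<epsilon>] \<epsilon> by auto
  have "sym_proj_norm scl N (tensor_power scl N x - tensor_power scl N y) \<le> \<epsilon>"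
    if x: "norm x = 1" and y: "norm (x - y) < \<delta>" for x y
  proof -
    define t where "t = norm (y - x)"
    define u where "u = (y - x) /\<^sub>R t"
    have u: "norm u \<le> 1" by (cases "y = x") (simp_all add: u_def t_def)
    have yx: "y = x + scl (of_real t) u" by (cases "y = x") (simp_all add: scale_of_real u_def t_def)
    have "sym_proj_norm scl N (tensor_power scl N x - tensor_power scl N y) =
        sym_proj_norm scl N (tensor_power scl N y - tensor_power scl N x)"
      using tensor_power_mem[of 1 N] by (intro S.p_commute) (simp_all add: tensor_scale_def)
    also have "\<dots> \<le> (\<Sum>j\<le>N. sym_proj_norm scl N (tensor_scale (poly (L j) (of_real t) - poly (L j) 0)
        (tensor_power scl N (x + scl (of_nat j) u))))"
      unfolding yx diff by (rule sym_proj_norm_sum_le[OF N]) (simp_all add: tensor_power_mem)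
    also have "\<dots> \<le> g t"
      unfolding g_def
    proof (rule sum_mono)
      fix j
      have "norm (x + scl (of_nat j) u) \<le> 1 + real j * 1"
        using norm_triangle_ineq[of x "scl (of_nat j) u"] x mult_left_mono[OF u, of "real j"]
        by (simp add: norm_scale)
      then have "norm (poly (L j) (of_real t) - poly (L j) 0) * norm (x + scl (of_nat j) u) ^ N
          \<le> norm (poly (L j) (of_real t) - poly (L j) 0) * (1 + real j) ^ N"
        by (intro mult_left_mono power_mono) simp_all
      then show "sym_proj_norm scl N (tensor_scale (poly (L j) (of_real t) - poly (L j) 0)
          (tensor_power scl N (x + scl (of_nat j) u)))
          \<le> norm (poly (L j) (of_real t) - poly (L j) 0) * (1 + real j) ^ N"
        using sym_proj_norm_power_le[OF N] order_trans by blast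
    qed
    also have "g t \<le> \<epsilon>"
    proof (cases "t = 0")
      case True
      then show ?thesis using \<open>g 0 = 0\<close> \<epsilon> by simp
    next
      case False
      then show ?thesis using \<delta>(2)[OF False] y by (simp add: t_def norm_minus_commute)
    qed
    finally show ?thesis .
  qed
  then show ?thesis using \<delta>(1) by blast
qed

end

section \<open>Norm attainment and density\<close>

context banach_space_over
begin

lemma sym_proj_norm_scale_le:
  assumes N: "N \<ge> 1" and t: "t \<in> sym_tensors scl N"
  shows "sym_proj_norm scl N (tensor_scale c t) \<le> norm c * sym_proj_norm scl N t"
proof (cases "c = 0")
  case True
  interpret S: seminorm_on "sym_tensors scl N" "sym_proj_norm scl N"
    using seminorm_on_sym_tensors[OF banach_space_over_axioms N] .
  interpret T: vector_space "tensor_scale :: 'k \<Rightarrow> ('k, 'a) tensor \<Rightarrow> _"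
    by (rule vector_space_tensor_scale)
  show ?thesis unfolding True T.scale_zero_left S.p_zero by simp
next
  case False
  interpret T: vector_space "tensor_scale :: 'k \<Rightarrow> ('k, 'a) tensor \<Rightarrow> _"
    by (rule vector_space_tensor_scale)
  have "sym_proj_norm scl N (tensor_scale c t) / norm c \<le> a" if a: "a \<in> sym_rep_costs scl N t" for a
  proof -
    obtain n d x where ax: "a = (\<Sum>k<n. norm (d k))" "\<forall>k<(n::nat). x k \<in> sphere 0 1"
      "t = (\<Sum>k<n. tensor_scale (d k) (tensor_power scl N (x k)))"
      using a by (auto simp: sym_rep_costs_def)
    have "tensor_scale c t = (\<Sum>k<n. tensor_scale (c * d k) (tensor_power scl N (x k)))"
      unfolding ax(3) T.scale_sum_right T.scale_scale ..
    then have "norm c * a \<in> sym_rep_costs scl N (tensor_scale c t)"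
      unfolding sym_rep_costs_def ax(1) using ax(2)
      by (intro CollectI exI[of _ n] exI[of _ "\<lambda>k. c * d k"] exI[of _ x])
        (simp add: norm_mult sum_distrib_left)
    then have "sym_proj_norm scl N (tensor_scale c t) \<le> norm c * a"
      unfolding sym_proj_norm_alt using sym_rep_costs_nonneg by (intro cInf_lower bdd_belowI)
    then show ?thesis using False by (simp add: field_simps)
  qed
  then have "sym_proj_norm scl N (tensor_scale c t) / norm c \<le> sym_proj_norm scl N t"
    unfolding sym_proj_norm_alt[of scl N t]
    using sym_rep_costs_nonempty[OF banach_space_over_axioms N t] by (intro cInf_greatest)
  then show ?thesis using False by (simp add: field_simps)
qed

lemma sym_proj_norm_attained:
  fixes N n :: nat and d :: "nat \<Rightarrow> 'k"
  assumes N: "N \<ge> 1" and B: "finite B" and P: "Vector_Spaces.linear scl scl P"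
    and contr: "\<And>x. norm (P x) \<le> norm x" and range: "range P = span B"
    and fix_w: "\<And>k. k < n \<Longrightarrow> P (w k) = w k"
    and z: "z = (\<Sum>k<n. tensor_scale (d k) (tensor_power scl N (w k)))"
  shows "\<exists>(D::nat) c y. (\<forall>k<D. norm (y k) \<le> 1) \<and>
    z = (\<Sum>k<D. tensor_scale (c k) (tensor_power scl N (y k))) \<and>
    (\<Sum>k<D. norm (c k)) = sym_proj_norm scl N z"
proof -
  let ?p = "sym_proj_norm scl N"
  obtain D :: nat where D: "\<And>(n::nat) c y. y ` {..<n} \<subseteq> span B \<Longrightarrow>
    \<exists>c' y'. y' ` {..<D} \<subseteq> insert 0 (y ` {..<n}) \<and>
      (\<Sum>k<D. norm (c' k)) \<le> (\<Sum>k<n. norm (c k)) \<and>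
      (\<Sum>k<D. tensor_scale (c' k) (tensor_power scl N (y' k))) =
      (\<Sum>k<n. tensor_scale (c k) (tensor_power scl N (y k)))"
    using sym_rep_bounded_length[OF vector_space_axioms B, of N] by blast
  define R where "R j c y \<longleftrightarrow> y ` {..<D} \<subseteq> span B \<inter> cball 0 1 \<and>
      (\<Sum>k<D. norm (c k)) \<le> ?p z + inverse (real (Suc j)) \<and>
      (\<Sum>k<D. tensor_scale (c k) (tensor_power scl N (y k))) = z" for j :: nat and c y
  have "\<exists>c y. R j c y" for j
  proof -
    have "z \<in> sym_tensors scl N" unfolding z by (rule sum_tensor_power_mem)
    then have "sym_rep_costs scl N z \<noteq> {}"
      using sym_rep_costs_nonempty[OF banach_space_over_axioms N] by blast
    moreover have "Inf (sym_rep_costs scl N z) < ?p z + inverse (real (Suc j))"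
      unfolding sym_proj_norm_alt by simp
    ultimately obtain a where a: "a \<in> sym_rep_costs scl N z" "a < ?p z + inverse (real (Suc j))"
      using cInf_lessD by blast
    then obtain m c x where m: "a = (\<Sum>k<m. norm (c k))" "\<forall>k<(m::nat). x k \<in> sphere 0 1"
      "z = (\<Sum>k<m. tensor_scale (c k) (tensor_power scl N (x k)))"
      by (auto simp: sym_rep_costs_def)
    have "(\<Sum>k<n. tensor_scale (d k) (tensor_power scl N (w k))) =
        (\<Sum>k<m. tensor_scale (c k) (tensor_power scl N (P (x k))))"
      by (rule sym_tensor_project[OF P]) (use fix_w m(3) z in auto)
    then have zP: "z = (\<Sum>k<m. tensor_scale (c k) (tensor_power scl N (P (x k))))"
      unfolding z .
    have "(\<lambda>k. P (x k)) ` {..<m} \<subseteq> span B" unfolding range[symmetric] by blast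
    from D[OF this, of c] obtain c' y' where "y' ` {..<D} \<subseteq> insert 0 ((\<lambda>k. P (x k)) ` {..<m})"
      "(\<Sum>k<D. norm (c' k)) \<le> a" "(\<Sum>k<D. tensor_scale (c' k) (tensor_power scl N (y' k))) = z"
      unfolding m(1) zP by blast
    moreover have "insert 0 ((\<lambda>k. P (x k)) ` {..<m}) \<subseteq> span B \<inter> cball 0 1"
    proof -
      have "norm (P (x k)) \<le> 1" if "k < m" for k using contr[of "x k"] m(2) that by simp
      then show ?thesis using range span_zero by auto
    qed
    ultimately show ?thesis using a(2) unfolding R_def
      by (intro exI[of _ c'] exI[of _ y'] conjI) (blast, linarith, assumption)
  qed
  then obtain c y where cyR: "\<And>j. R j (c j) (y j)" by metis
  have y: "y j ` {..<D} \<subseteq> span B \<inter> cball 0 1"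
    and c: "(\<Sum>k<D. norm (c j k)) \<le> ?p z + inverse (real (Suc j))"
    and cy: "(\<Sum>k<D. tensor_scale (c j k) (tensor_power scl N (y j k))) = z" for j
    using cyR[of j] unfolding R_def by blast+
  define Q where "Q k r \<longleftrightarrow> (\<exists>\<gamma> v. (\<lambda>j. c (r j) k) \<longlonglongrightarrow> \<gamma> \<and> norm v \<le> 1 \<and>
      (\<forall>A. multilinear_map scl (*) N A \<longrightarrow>
        (\<lambda>j. A (replicate N (y (r j) k))) \<longlonglongrightarrow> A (replicate N v)))" for k and r :: "nat \<Rightarrow> nat"
  have "\<exists>r. strict_mono r \<and> (\<forall>k\<in>{..<D}. Q k r)"
  proof (rule finite_common_subseq)
    fix k and r :: "nat \<Rightarrow> nat" assume k: "k \<in> {..<D}" and r: "strict_mono r"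
    have "norm (c j k) \<le> ?p z + 1" for j
    proof -
      have "norm (c j k) \<le> (\<Sum>k<D. norm (c j k))" using k by (intro member_le_sum) auto
      moreover have "inverse (real (Suc j)) \<le> 1" by (simp add: inverse_le_1_iff)
      ultimately show ?thesis using c[of j] by linarith
    qed
    then have "bounded (range (\<lambda>j. c (r j) k))" by (auto simp: bounded_iff)
    then obtain \<gamma> r1 where r1: "strict_mono (r1 :: nat \<Rightarrow> nat)" "((\<lambda>j. c (r j) k) \<circ> r1) \<longlonglongrightarrow> \<gamma>"
      using bounded_imp_convergent_subsequence by blast
    have yk: "y j k \<in> span B" "norm (y j k) \<le> 1" for j using y[of j] k by auto
    have "bounded (range (\<lambda>j. y (r (r1 j)) k))" using yk(2) by (auto simp: bounded_iff)
    then obtain r2 a \<alpha> where r2: "strict_mono r2"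
      "\<forall>j. y (r (r1 (r2 j))) k = (\<Sum>b\<in>B. scl (a j b) b)" "\<forall>b\<in>B. (\<lambda>j. a j b) \<longlonglongrightarrow> \<alpha> b"
      using span_bounded_subseq[OF B, of "\<lambda>j. y (r (r1 j)) k"] yk(1) by blast
    let ?v = "\<Sum>b\<in>B. scl (\<alpha> b) b"
    have "(\<lambda>j. \<Sum>b\<in>B. scl (a j b) b) \<longlonglongrightarrow> ?v"
      using r2(3) by (intro tendsto_sum tendsto_scl) auto
    then have "(\<lambda>j. norm (y (r (r1 (r2 j))) k)) \<longlonglongrightarrow> norm ?v"
      unfolding r2(2)[rule_format] by (rule tendsto_norm)
    then have "norm ?v \<le> 1" by (rule LIMSEQ_le_const2) (use yk(2) in blast)
    moreover have "(\<lambda>j. c (r (r1 (r2 j))) k) \<longlonglongrightarrow> \<gamma>"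
      using LIMSEQ_subseq_LIMSEQ[OF r1(2) r2(1)] by (simp add: o_def)
    moreover have "(\<lambda>j. A (replicate N (y (r (r1 (r2 j))) k))) \<longlonglongrightarrow> A (replicate N ?v)"
      if "multilinear_map scl (*) N A" for A
      unfolding r2(2)[rule_format] using multilinear_power_tendsto[OF that] r2(3) by blast
    ultimately have "Q k (r \<circ> (r1 \<circ> r2))" unfolding Q_def o_def by blast
    then show "\<exists>r'. strict_mono r' \<and> Q k (r \<circ> r')" using strict_mono_o[OF r1(1) r2(1)] by blast
  next
    fix k and r r' :: "nat \<Rightarrow> nat" assume "Q k r" and r': "strict_mono r'"
    then show "Q k (r \<circ> r')"
      unfolding Q_def using LIMSEQ_subseq_LIMSEQ[OF _ r', unfolded o_def] by (fastforce simp: o_def)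
  qed simp
  then obtain r where r: "strict_mono r" "\<And>k. k < D \<Longrightarrow> Q k r" by auto
  then obtain \<gamma> v where \<gamma>: "\<And>k. k < D \<Longrightarrow> (\<lambda>j. c (r j) k) \<longlonglongrightarrow> \<gamma> k"
    and v: "\<And>k. k < D \<Longrightarrow> norm (v k) \<le> 1"
    and A: "\<And>k A. k < D \<Longrightarrow> multilinear_map scl (*) N A \<Longrightarrow>
      (\<lambda>j. A (replicate N (y (r j) k))) \<longlonglongrightarrow> A (replicate N (v k))"
    unfolding Q_def by metis
  have zv: "z = (\<Sum>k<D. tensor_scale (\<gamma> k) (tensor_power scl N (v k)))"
  proof
    fix A :: "'a list \<Rightarrow> 'k"
    show "z A = (\<Sum>k<D. tensor_scale (\<gamma> k) (tensor_power scl N (v k))) A"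
    proof (cases "multilinear_map scl (*) N A")
      case True
      have "(\<lambda>j. \<Sum>k<D. c (r j) k * A (replicate N (y (r j) k))) \<longlonglongrightarrow> (\<Sum>k<D. \<gamma> k * A (replicate N (v k)))"
        by (intro tendsto_sum tendsto_mult \<gamma> A True) auto
      moreover have "(\<Sum>k<D. c (r j) k * A (replicate N (y (r j) k))) = z A" for j
        using fun_cong[OF cy[of "r j"], of A] True
        by (simp add: sum_tensor_apply tensor_scale_def tensor_power_def pure_tensor_def)
      ultimately have "z A = (\<Sum>k<D. \<gamma> k * A (replicate N (v k)))"
        by (simp add: LIMSEQ_const_iff)
      then show ?thesis using True
        by (simp add: sum_tensor_apply tensor_scale_def tensor_power_def pure_tensor_def)
    next
      case False
      then show ?thesis unfolding z
        by (simp add: sum_tensor_apply tensor_scale_def tensor_power_def pure_tensor_def)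
    qed
  qed
  have "(\<Sum>k<D. norm (\<gamma> k)) \<le> ?p z"
  proof (rule LIMSEQ_le)
    show "(\<lambda>j. \<Sum>k<D. norm (c (r j) k)) \<longlonglongrightarrow> (\<Sum>k<D. norm (\<gamma> k))"
      by (intro tendsto_sum tendsto_norm \<gamma>) auto
    show "(\<lambda>j. ?p z + inverse (real (Suc (r j)))) \<longlonglongrightarrow> ?p z"
      using tendsto_add[OF tendsto_const LIMSEQ_subseq_LIMSEQ[OF LIMSEQ_inverse_real_of_nat r(1)], of "?p z"]
      by (simp add: o_def)
  qed (use c in blast)
  moreover have "?p z \<le> (\<Sum>k<D. norm (\<gamma> k))"
    unfolding zv using sym_proj_norm_rep_le[OF N, of "{..<D}" v \<gamma>] v by simp
  ultimately show ?thesis using v zv by (intro exI[of _ D] exI[of _ \<gamma>] exI[of _ v]) auto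
qed

lemma embed_mem_NA_sym:
  fixes D :: nat
  assumes N: "N \<ge> 1" and y: "\<And>k. k < D \<Longrightarrow> norm (y k) \<le> 1"
    and z: "z = (\<Sum>k<D. tensor_scale (c k) (tensor_power scl N (y k)))"
    and c: "(\<Sum>k<D. norm (c k)) = sym_proj_norm scl N z"
  shows "completion_embed (sym_tensors scl N) (sym_proj_norm scl N) z \<in> NA_sym scl N"
proof -
  interpret S: seminorm_on "sym_tensors scl N" "sym_proj_norm scl N"
    using seminorm_on_sym_tensors[OF banach_space_over_axioms N] .
  interpret M: Metric_space "cauchy_completion (sym_tensors scl N) (sym_proj_norm scl N)"
    "completion_dist (sym_tensors scl N) (sym_proj_norm scl N)" by (rule S.Metric_space_completion)
  interpret T: vector_space "tensor_scale :: 'k \<Rightarrow> ('k, 'a) tensor \<Rightarrow> _"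
    by (rule vector_space_tensor_scale)
  let ?E = "completion_embed (sym_tensors scl N) (sym_proj_norm scl N)"
  define c' where "c' k = (if k < D then c k else 0)" for k
  define y' where "y' k = (if k < D then y k else 0)" for k
  have zV: "z \<in> sym_tensors scl N" unfolding z by (rule sum_tensor_power_mem)
  have part: "(\<Sum>n<m. tensor_scale (c' n) (tensor_power scl N (y' n))) = z" if "m \<ge> D" for m
  proof -
    have "(\<Sum>n<m. tensor_scale (c' n) (tensor_power scl N (y' n))) =
        (\<Sum>n<D. tensor_scale (c' n) (tensor_power scl N (y' n)))"
      using that by (intro sum.mono_neutral_right) (auto simp: c'_def)
    also have "\<dots> = z" unfolding z by (intro sum.cong) (auto simp: c'_def y'_def)
    finally show ?thesis .
  qed
  have "range c' \<subseteq> insert 0 (c ` {..<D})" by (auto simp: c'_def)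
  then have "bounded (range c')" by (rule bounded_subset[rotated]) (simp add: finite_imp_bounded)
  moreover have "range y' \<subseteq> cball 0 1" using y by (auto simp: y'_def)
  moreover have "limitin (proj_sym_topology scl N)
      (\<lambda>m. ?E (\<Sum>n<m. tensor_scale (c' n) (tensor_power scl N (y' n)))) (?E z) sequentially"
    unfolding proj_sym_topology_def completion_topology_def
  proof (rule limitin_eventually)
    show "?E z \<in> topspace M.mtopology" using S.completion_embed_mem[OF zV] by simp
    show "\<forall>\<^sub>F m in sequentially. ?E (\<Sum>n<m. tensor_scale (c' n) (tensor_power scl N (y' n))) = ?E z"
      unfolding eventually_sequentially using part by blast
  qed
  moreover have "(\<lambda>n. norm (c' n)) sums completion_norm (sym_proj_norm scl N) (?E z)"
  proof -
    have "(\<lambda>n. norm (c' n)) sums (\<Sum>n<D. norm (c' n))"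
      by (rule sums_finite) (auto simp: c'_def)
    moreover have "(\<Sum>n<D. norm (c' n)) = completion_norm (sym_proj_norm scl N) (?E z)"
      unfolding S.completion_norm_embed[OF zV] c[symmetric] by (intro sum.cong) (auto simp: c'_def)
    ultimately show ?thesis by simp
  qed
  moreover have "?E z \<in> proj_sym_tensor_product scl N"
    unfolding proj_sym_tensor_product_def by (rule S.completion_embed_mem[OF zV])
  ultimately show ?thesis unfolding NA_sym_def by blast
qed

lemma NA_sym_approx:
  assumes pi: "metric_pi_property scl" and N: "N \<ge> 1" and u: "u \<in> sym_tensors scl N" and \<epsilon>: "\<epsilon> > 0"
  shows "\<exists>z\<in>sym_tensors scl N. sym_proj_norm scl N (u - z) < \<epsilon> \<and>
    completion_embed (sym_tensors scl N) (sym_proj_norm scl N) z \<in> NA_sym scl N"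
proof -
  interpret S: seminorm_on "sym_tensors scl N" "sym_proj_norm scl N"
    using seminorm_on_sym_tensors[OF banach_space_over_axioms N] .
  interpret T: vector_space "tensor_scale :: 'k \<Rightarrow> ('k, 'a) tensor \<Rightarrow> _"
    by (rule vector_space_tensor_scale)
  let ?p = "sym_proj_norm scl N"
  have "sym_rep_costs scl N u \<noteq> {}"
    by (rule sym_rep_costs_nonempty[OF banach_space_over_axioms N u])
  then obtain n c x where x: "\<And>k. k < (n::nat) \<Longrightarrow> x k \<in> sphere 0 1"
    and ux: "u = (\<Sum>k<n. tensor_scale (c k) (tensor_power scl N (x k)))"
    by (auto simp: sym_rep_costs_def)
  show ?thesis
  proof (cases "n = 0")
    case True
    then have "u = 0" unfolding ux by simp
    then have "?p (u - u) < \<epsilon>" "completion_embed (sym_tensors scl N) ?p u \<in> NA_sym scl N"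
      using \<epsilon> S.p_zero embed_mem_NA_sym[OF N, of 0 _ u] by auto
    then show ?thesis using u by blast
  next
    case False
    define C where "C = (\<Sum>k<n. norm (c k))"
    have C: "C \<ge> 0" unfolding C_def by (intro sum_nonneg) simp
    define \<eta> where "\<eta> = \<epsilon> / (C + 1)"
    have \<eta>: "\<eta> > 0" using C \<epsilon> by (simp add: \<eta>_def)
    obtain \<delta> where \<delta>: "\<delta> > 0" "\<And>x y. norm x = 1 \<Longrightarrow> norm (x - y) < \<delta> \<Longrightarrow>
        ?p (tensor_power scl N x - tensor_power scl N y) \<le> \<eta>"
      using tensor_power_continuous[OF N \<eta>] by blast
    have "finite (x ` {..<n})" "x ` {..<n} \<noteq> {}" "x ` {..<n} \<subseteq> sphere 0 1"
      using False x by auto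
    then obtain M where M: "finite_dimensional_subspace scl M" "one_complemented scl M"
      "\<forall>v\<in>x ` {..<n}. \<exists>v'\<in>M. norm (v - v') < \<delta>"
      using pi \<delta>(1) unfolding metric_pi_property_def by blast
    obtain B where B: "finite B" "M = span B" using M(1) unfolding finite_dimensional_subspace_def by blast
    obtain P where P: "Vector_Spaces.linear scl scl P" "bounded_linear P" "P \<circ> P = P" "onorm P = 1"
      "range P = M" using M(2) unfolding one_complemented_def by blast
    have contr: "norm (P v) \<le> norm v" for v using onorm[OF P(2), of v] P(4) by simp
    have idem: "P v = v" if "v \<in> M" for v using that P(3,5) by (auto simp: fun_eq_iff)
    have "\<exists>v'\<in>M. norm (x k - v') < \<delta>" if "k < n" for k using M(3) that by blast
    then obtain w where w: "\<And>k. k < n \<Longrightarrow> w k \<in> M" "\<And>k. k < n \<Longrightarrow> norm (x k - w k) < \<delta>" by metis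
    define z where "z = (\<Sum>k<n. tensor_scale (c k) (tensor_power scl N (w k)))"
    have zV: "z \<in> sym_tensors scl N" unfolding z_def by (rule sum_tensor_power_mem)
    have tp: "tensor_power scl N v \<in> sym_tensors scl N" for v
      unfolding sym_tensors_def by (intro T.span_base) simp
    have uz: "u - z = (\<Sum>k<n. tensor_scale (c k) (tensor_power scl N (x k) - tensor_power scl N (w k)))"
      unfolding ux z_def T.scale_right_diff_distrib sum_subtractf ..
    have "?p (u - z) \<le> (\<Sum>k<n. ?p (tensor_scale (c k) (tensor_power scl N (x k) - tensor_power scl N (w k))))"
      unfolding uz using S.diff_mem[OF tp tp] unfolding sym_tensors_def
      by (intro sym_proj_norm_sum_le[OF N, unfolded sym_tensors_def] T.span_scale) auto
    also have "\<dots> \<le> (\<Sum>k<n. norm (c k) * \<eta>)"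
    proof (rule sum_mono)
      fix k assume "k \<in> {..<n}"
      then have "?p (tensor_power scl N (x k) - tensor_power scl N (w k)) \<le> \<eta>"
        using \<delta>(2) x w(2) by simp
      then have "norm (c k) * ?p (tensor_power scl N (x k) - tensor_power scl N (w k)) \<le> norm (c k) * \<eta>"
        by (intro mult_left_mono) auto
      then show "?p (tensor_scale (c k) (tensor_power scl N (x k) - tensor_power scl N (w k))) \<le> norm (c k) * \<eta>"
        using sym_proj_norm_scale_le[OF N S.diff_mem[OF tp tp]] order_trans by blast
    qed
    also have "\<dots> = C * \<eta>" by (simp add: C_def sum_distrib_right)
    also have "\<dots> < (C + 1) * \<eta>" using \<eta> by simp
    also have "\<dots> = \<epsilon>" using C by (simp add: \<eta>_def)
    finally have "?p (u - z) < \<epsilon>" .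
    moreover obtain D' c' y' where "\<forall>k<(D'::nat). norm (y' k) \<le> 1"
      "z = (\<Sum>k<D'. tensor_scale (c' k) (tensor_power scl N (y' k)))"
      "(\<Sum>k<D'. norm (c' k)) = ?p z"
      using sym_proj_norm_attained[OF N B(1) P(1) contr _ _ z_def] P(5) B(2) idem w(1) by auto
    then have "completion_embed (sym_tensors scl N) ?p z \<in> NA_sym scl N"
      using embed_mem_NA_sym[OF N] by blast
    ultimately show ?thesis using zV by blast
  qed
qed

end

theorem theorem3p6:
  fixes scl :: "'k::{real_normed_field, euclidean_space} \<Rightarrow> 'a::banach \<Rightarrow> 'a"
    and N :: nat
  assumes "banach_space_over scl"
    and "metric_pi_property scl"
    and "N \<ge> 1"
  shows "proj_sym_topology scl N closure_of NA_sym scl N = proj_sym_tensor_product scl N"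
proof -
  let ?V = "sym_tensors scl N" and ?p = "sym_proj_norm scl N"
  interpret X: banach_space_over scl by fact
  interpret S: seminorm_on ?V ?p by (rule seminorm_on_sym_tensors[OF assms(1,3)])
  interpret M: Metric_space "cauchy_completion ?V ?p" "completion_dist ?V ?p"
    by (rule S.Metric_space_completion)
  have "\<exists>W\<in>NA_sym scl N. W \<in> M.mball U r" if U: "U \<in> cauchy_completion ?V ?p" and r: "r > 0" for U r
  proof -
    obtain u where u: "u \<in> U" using S.completion_nonempty[OF U] by blast
    have "\<forall>\<^sub>F m in sequentially. completion_dist ?V ?p U (completion_embed ?V ?p (u m)) < r / 2"
      using order_tendstoD(2)[OF S.completion_embed_approx[OF U u], of "r / 2"] r by simp
    then obtain m where m: "completion_dist ?V ?p U (completion_embed ?V ?p (u m)) < r / 2"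
      using eventually_happens' sequentially_bot by blast
    have um: "u m \<in> ?V" by (rule S.cauchy_memD[OF S.completion_memD[OF U u]])
    obtain z where z: "z \<in> ?V" "?p (u m - z) < r / 2" "completion_embed ?V ?p z \<in> NA_sym scl N"
      using X.NA_sym_approx[OF assms(2,3) um, of "r / 2"] r by auto
    note E = S.completion_embed_mem[OF um] S.completion_embed_mem[OF z(1)]
    have "completion_dist ?V ?p U (completion_embed ?V ?p z) < r"
      using M.triangle[OF U E] m z(2) S.completion_dist_embed[OF um z(1)] by linarith
    then show ?thesis using z(3) U E(2) by (intro bexI[of _ "completion_embed ?V ?p z"]) auto
  qed
  then show ?thesis
    unfolding proj_sym_topology_def completion_topology_def proj_sym_tensor_product_def
      M.metric_closure_of by auto
qed

end
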